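(* Let $C(S^1)^{(n)}\subset M_n(\mathbb C)$ denote the Toeplitz operator system of $n\times n$ Toeplitz matrices, $n\ge1$. 1. The extreme rays in $C(S^1)^{(n)}_+$ are given by the (positive multiples of) $\gamma(\lambda)=|f_\lambda\rangle\langle f_\lambda|$, $\lambda\in S^1$. In other words, the extreme rays $T=(t_{k-l})_{k,l}$ are of the form $t_k=\lambda^k$ (up to a positive real number) for some $|\lambda|=1$. 2. The pure states of $C(S^1)^{(n+1)}$ are given by the functionals $T\mapsto\langle\xi,T\xi\rangle$ where $\xi=(\xi_0,\dots,\xi_n)\in\mathbb C^{n+1}$ is a unit vector such that the polynomial $z\mapsto\sum_k\xi_kz^{n-k}$ has all its $n$ zeroes (counted with multiplicity) on $S^1$. 3. The pure state space $\mathcal P(C(S^1)^{(n+1)})\cong\mathbb T^n/S_n$ is the quotient of the $n$-torus by the symmetric group on $n$ objects.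
   Context: $C(S^1)^{(n)}$ is the operator system of $n\times n$ matrices $(t_{k-l})_{k,l}$ with $t_j\in\mathbb C$, $|j|\le n-1$; its positive cone $C(S^1)^{(n)}_+$ consists of the positive semidefinite ones. For $z\in\mathbb C$, $f_z=\frac1{\sqrt n}(1,z,z^2,\dots,z^{n-1})^t\in\mathbb C^n$, and $|f\rangle\langle f|$ is the rank one operator $\eta\mapsto\langle f,\eta\rangle f$ (inner product antilinear in the first variable). A nonzero element $x$ of a cone spans an extreme ray if $0\le y\le x$ implies that $y$ is a multiple of $x$. States are positive linear functionals with value $1$ on the unit, pure states are the extreme points of the state space, and the pure state space $\mathcal P$ is the weak-$*$ closure of the set of pure states; $\cong$ denotes homeomorphism. *)

theory Defs
  imports
    "HOL-Analysis.Analysis"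
    "HOL-Computational_Algebra.Polynomial"
    "HOL-Combinatorics.Permutations"
    "Jordan_Normal_Form.Matrix"
begin

(* Both HOL-Analysis and Jordan_Normal_Form provide vectors and matrices; those of the latter
   are used throughout, since their dimension is a term. *)
hide_type (open) Finite_Cartesian_Product.vec
hide_const (open) Finite_Cartesian_Product.vec Finite_Cartesian_Product.mat
no_notation Finite_Cartesian_Product.vec_nth (infixl \<open>$\<close> 90)

section \<open>The Toeplitz operator system\<close>

definition toeplitz_mat :: "nat \<Rightarrow> (int \<Rightarrow> complex) \<Rightarrow> complex Matrix.mat" where
  "toeplitz_mat n t = Matrix.mat n n (\<lambda>(k, l). t (int k - int l))"

definition toeplitz_sys :: "nat \<Rightarrow> complex Matrix.mat set" where
  "toeplitz_sys n = range (toeplitz_mat n)"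

(* Antilinear in the first argument; the library's complex scalar product is antilinear
   in the second. *)
definition hinner :: "complex Matrix.vec \<Rightarrow> complex Matrix.vec \<Rightarrow> complex" where
  "hinner v w = w \<bullet>c v"

(* The order on the complex numbers is that of HOL-Library.Complex_Order: 0 \<le> z means that z is
   real and non-negative. *)
definition psd :: "nat \<Rightarrow> complex Matrix.mat \<Rightarrow> bool" where
  "psd n T \<longleftrightarrow> T \<in> carrier_mat n n \<and> (\<forall>v \<in> carrier_vec n. 0 \<le> hinner v (T *\<^sub>v v))"

definition toeplitz_cone :: "nat \<Rightarrow> complex Matrix.mat set" where
  "toeplitz_cone n = {T \<in> toeplitz_sys n. psd n T}"

(* 0 \<le> Y \<le> X in the order given by the cone means that both Y and X - Y are in the cone. *)
definition spans_extreme_ray :: "nat \<Rightarrow> complex Matrix.mat \<Rightarrow> bool" where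
  "spans_extreme_ray n X \<longleftrightarrow>
     X \<in> toeplitz_cone n \<and> X \<noteq> 0\<^sub>m n n \<and>
     (\<forall>Y. Y \<in> toeplitz_cone n \<and> X - Y \<in> toeplitz_cone n \<longrightarrow> (\<exists>c. Y = c \<cdot>\<^sub>m X))"

definition fvec :: "nat \<Rightarrow> complex \<Rightarrow> complex Matrix.vec" where
  "fvec n z = Matrix.vec n (\<lambda>k. z ^ k / complex_of_real (sqrt (real n)))"

definition ketbra :: "complex Matrix.vec \<Rightarrow> complex Matrix.mat" where
  "ketbra f = Matrix.mat (dim_vec f) (dim_vec f) (\<lambda>(k, l). vec_index f k * cnj (vec_index f l))"

lemma ketbra_mult_vec:
  assumes "\<eta> \<in> carrier_vec (dim_vec f)"
  shows "ketbra f *\<^sub>v \<eta> = hinner f \<eta> \<cdot>\<^sub>v f"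
  using assms
  by (intro eq_vecI)
     (auto simp: ketbra_def hinner_def scalar_prod_def sum_distrib_left sum_distrib_right mult_ac)

definition gamma_toeplitz :: "nat \<Rightarrow> complex \<Rightarrow> complex Matrix.mat" where
  "gamma_toeplitz n z = ketbra (fvec n z)"

section \<open>States\<close>

(* Functionals on the operator system are represented by functions that are undefined outside
   it, so that equality of functionals is equality of functions. *)
definition dual :: "nat \<Rightarrow> (complex Matrix.mat \<Rightarrow> complex) set" where
  "dual n = {\<phi> \<in> extensional (toeplitz_sys n).
     (\<forall>S \<in> toeplitz_sys n. \<forall>T \<in> toeplitz_sys n. \<phi> (S + T) = \<phi> S + \<phi> T) \<and>
     (\<forall>c. \<forall>T \<in> toeplitz_sys n. \<phi> (c \<cdot>\<^sub>m T) = c * \<phi> T)}"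

(* Topology of pointwise convergence on the operator system *)
definition weak_star :: "nat \<Rightarrow> (complex Matrix.mat \<Rightarrow> complex) topology" where
  "weak_star n = subtopology (product_topology (\<lambda>_. euclidean) (toeplitz_sys n)) (dual n)"

definition state_space :: "nat \<Rightarrow> (complex Matrix.mat \<Rightarrow> complex) set" where
  "state_space n = {\<phi> \<in> dual n. (\<forall>T \<in> toeplitz_cone n. 0 \<le> \<phi> T) \<and> \<phi> (1\<^sub>m n) = 1}"

definition pure_states :: "nat \<Rightarrow> (complex Matrix.mat \<Rightarrow> complex) set" where
  "pure_states n = {\<phi> \<in> state_space n.
     \<forall>\<psi> \<in> state_space n. \<forall>\<theta> \<in> state_space n. \<forall>s::real.
       0 < s \<and> s < 1 \<and>
       (\<forall>T \<in> toeplitz_sys n. \<phi> T = complex_of_real s * \<psi> T + complex_of_real (1 - s) * \<theta> T)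
       \<longrightarrow> \<psi> = \<phi> \<and> \<theta> = \<phi>}"

definition pure_state_space :: "nat \<Rightarrow> (complex Matrix.mat \<Rightarrow> complex) topology" where
  "pure_state_space n = subtopology (weak_star n) (weak_star n closure_of pure_states n)"

definition vector_functional ::
    "nat \<Rightarrow> complex Matrix.vec \<Rightarrow> complex Matrix.mat \<Rightarrow> complex" where
  "vector_functional n \<xi> = (\<lambda>T \<in> toeplitz_sys n. hinner \<xi> (T *\<^sub>v \<xi>))"

definition vec_poly :: "nat \<Rightarrow> complex Matrix.vec \<Rightarrow> complex poly" where
  "vec_poly n \<xi> = (\<Sum>k\<le>n. monom (vec_index \<xi> k) (n - k))"

lemma poly_vec_poly: "poly (vec_poly n \<xi>) z = (\<Sum>k\<le>n. vec_index \<xi> k * z ^ (n - k))"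
  by (simp add: vec_poly_def poly_sum poly_monom)

(* proots is the multiset of zeroes. Requiring n of them forces the degree to be exactly n,
   that is, the leading coefficient \<xi>_0 to be nonzero. *)
definition all_zeroes_on_circle :: "nat \<Rightarrow> complex poly \<Rightarrow> bool" where
  "all_zeroes_on_circle n p \<longleftrightarrow> size (proots p) = n \<and> set_mset (proots p) \<subseteq> sphere 0 1"

section \<open>The quotient of the torus by the symmetric group\<close>

definition quotient_topology :: "'a topology \<Rightarrow> ('a \<times> 'a) set \<Rightarrow> 'a set topology" where
  "quotient_topology X r = topology (\<lambda>U.
     U \<subseteq> topspace X // r \<and> openin X {x \<in> topspace X. r `` {x} \<in> U})"

lemma openin_quotient_topology:
  "openin (quotient_topology X r) U \<longleftrightarrow>
     U \<subseteq> topspace X // r \<and> openin X {x \<in> topspace X. r `` {x} \<in> U}"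
proof -
  let ?P = "\<lambda>U. {x \<in> topspace X. r `` {x} \<in> U}"
  have Int: "?P (S \<inter> T) = ?P S \<inter> ?P T" for S T by auto
  have Un: "?P (\<Union>K) = \<Union>(?P ` K)" for K by auto
  have "istopology (\<lambda>U. U \<subseteq> topspace X // r \<and> openin X (?P U))"
    unfolding istopology_def Int Un by (blast intro: openin_Int openin_Union)
  then show ?thesis
    by (simp add: quotient_topology_def topology_inverse')
qed

lemma quotient_map_quotient_topology:
  "quotient_map X (quotient_topology X r) (\<lambda>x. r `` {x})"
proof -
  have "{x \<in> topspace X. r `` {x} \<in> topspace X // r} = topspace X"
    by (auto intro: quotientI)
  then have "openin X {x \<in> topspace X. r `` {x} \<in> topspace X // r}"
    by simp
  then have "openin (quotient_topology X r) (topspace X // r)"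
    by (simp add: openin_quotient_topology)
  then have "topspace X // r \<subseteq> topspace (quotient_topology X r)"
    by (rule openin_subset)
  moreover have "topspace (quotient_topology X r) \<subseteq> topspace X // r"
    using openin_topspace[of "quotient_topology X r"] unfolding openin_quotient_topology by simp
  ultimately have top: "topspace (quotient_topology X r) = topspace X // r"
    by simp
  have image: "(\<lambda>x. r `` {x}) ` topspace X = topspace X // r"
    by (auto simp: quotient_def)
  show ?thesis
    unfolding quotient_map_def top image openin_quotient_topology by simp
qed

definition torus :: "nat \<Rightarrow> (nat \<Rightarrow> complex) topology" where
  "torus n = product_topology (\<lambda>_. top_of_set (sphere 0 1)) {..<n}"

definition perm_rel :: "nat \<Rightarrow> ((nat \<Rightarrow> complex) \<times> (nat \<Rightarrow> complex)) set" where
  "perm_rel n = {(x, x \<circ> p) | x p. x \<in> topspace (torus n) \<and> p permutes {..<n}}"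

lemma in_perm_rel:
  "(x, y) \<in> perm_rel n \<longleftrightarrow>
     x \<in> topspace (torus n) \<and> (\<exists>p. p permutes {..<n} \<and> y = x \<circ> p)"
  unfolding perm_rel_def by blast

lemma in_torus:
  "x \<in> topspace (torus n) \<longleftrightarrow> (\<forall>i<n. cmod (x i) = 1) \<and> (\<forall>i\<ge>n. x i = undefined)"
  by (simp add: torus_def PiE_iff extensional_def Ball_def not_less)

lemma torus_permute:
  assumes x: "x \<in> topspace (torus n)" and p: "p permutes {..<n}"
  shows "x \<circ> p \<in> topspace (torus n)"
proof -
  have "p i < n" if "i < n" for i
    using permutes_in_image[OF p, of i] that by simp
  moreover have "p i = i" if "i \<ge> n" for i
    using permutes_not_in[OF p, of i] that by simp
  ultimately show ?thesis
    using x by (simp add: in_torus)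
qed

lemma equiv_perm_rel: "equiv (topspace (torus n)) (perm_rel n)"
proof (rule equivI)
  show "perm_rel n \<subseteq> topspace (torus n) \<times> topspace (torus n)"
    by (auto simp: in_perm_rel torus_permute simp del: o_apply)
  show "refl_on (topspace (torus n)) (perm_rel n)"
  proof (rule refl_onI)
    fix x assume "x \<in> topspace (torus n)"
    moreover have "id permutes {..<n}" "x = x \<circ> id"
      by (simp_all add: permutes_id)
    ultimately show "(x, x) \<in> perm_rel n"
      unfolding in_perm_rel by metis
  qed
  show "sym (perm_rel n)"
  proof (rule symI)
    fix x y assume "(x, y) \<in> perm_rel n"
    then obtain p where x: "x \<in> topspace (torus n)" and p: "p permutes {..<n}"
        and y: "y = x \<circ> p"
      unfolding in_perm_rel by blast
    have "x = y \<circ> inv_into UNIV p"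
      unfolding y comp_assoc permutes_inv_o(1)[OF p] by simp
    then show "(y, x) \<in> perm_rel n"
      unfolding in_perm_rel using torus_permute[OF x p] permutes_inv[OF p] y by metis
  qed
  show "trans (perm_rel n)"
  proof (rule transI)
    fix x y z assume "(x, y) \<in> perm_rel n" "(y, z) \<in> perm_rel n"
    then obtain p q where x: "x \<in> topspace (torus n)"
        and pq: "p permutes {..<n}" "q permutes {..<n}" and z: "z = (x \<circ> p) \<circ> q"
      unfolding in_perm_rel by blast
    show "(x, z) \<in> perm_rel n"
      unfolding in_perm_rel z comp_assoc using x permutes_compose[OF pq(2,1)] by metis
  qed
qed

definition torus_mod_sym :: "nat \<Rightarrow> (nat \<Rightarrow> complex) set topology" where
  "torus_mod_sym n = quotient_topology (torus n) (perm_rel n)"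

end

(* Functionals on the (n+1) x (n+1) Toeplitz matrices pair the symbol with a trigonometric
   polynomial of degree at most n. By the Fejer-Riesz factorization R = |p|^2, the nonnegative
   trigonometric polynomials give exactly the positive functionals, and they are all vector
   functionals. If p has all its zeroes on the circle, then every S with 0 \<le> S \<le> R has the
   zeroes of R and is a multiple of R, so the state is pure. If p has fewer zeroes on the circle,
   then R has a strictly positive factor of degree one, which can be perturbed in both directions.
   Hence the pure states are the continuous image of the compact torus under (zeroes of p), which
   identifies points exactly up to permutation; in particular they form a closed set.

   For the extreme rays, a positive T makes multiplication by z isometric for the form
   <p, q>_T on polynomials. So a zero w of a null polynomial of minimal degree lies on the circle,
   and all null polynomials vanish at w. Evaluation at w is then bounded for the form, that is,
   T - \<epsilon> gamma(w) is positive for some \<epsilon> > 0. *)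

theory Submission
  imports Defs "HOL-Computational_Algebra.Fundamental_Theorem_Algebra"
begin

section \<open>Nonnegative trigonometric polynomials\<close>

hide_const (open) Module.module.smult

text \<open>Encoding the trigonometric polynomial z^(-n) R(z) by the ordinary polynomial R makes
  division, zeroes and the fundamental theorem of algebra available. The bound n travels along as a
  parameter because the degree may drop: a missing top degree acts as a zero at infinity, which is
  off the circle, and needs its own case in both the factorization and the purity argument.

  For the extreme rays the obstacle is that multiplication by z is isometric only while the degree
  stays at most n, so the null polynomials do not form an ideal. A multiple of a null polynomial is
  still null if the degrees of the factors add up to at most n, and this suffices: evaluation at w
  is represented below the minimal degree, where the form is definite, and division with remainder
  carries it to all degrees up to n. Without null polynomials any point of the circle serves as
  w.\<close>

lemma infinite_circle: "infinite (sphere (0::complex) 1)"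
proof -
  have "connected (sphere (0::complex) 1)"
    by (rule connected_sphere) simp
  moreover have "1 \<in> sphere (0::complex) 1" "-1 \<in> sphere (0::complex) 1"
    by simp_all
  ultimately show ?thesis
    using connected_finite_iff_sing[of "sphere (0::complex) 1"]
    by (metis empty_iff one_neq_neg_one singletonD)
qed

lemma poly_eqI_circle:
  fixes p q :: "complex poly"
  assumes "\<And>z. cmod z = 1 \<Longrightarrow> poly p z = poly q z"
  shows "p = q"
proof (rule ccontr)
  assume "p \<noteq> q"
  then have "finite {z. poly (p - q) z = 0}"
    by (intro poly_roots_finite) simp
  moreover have "sphere 0 1 \<subseteq> {z. poly (p - q) z = 0}"
    using assms by auto
  ultimately show False
    using finite_subset infinite_circle by blast
qed

lemma cnj_eq_inverse_circle: "cmod z = 1 \<Longrightarrow> cnj z = 1 / z"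
  by (metis complex_div_cnj complex_cnj_one div_by_1 mult_1 of_real_1 power_one)

lemma mult_cnj_circle: "cmod z = 1 \<Longrightarrow> z * cnj z = 1"
  by (simp add: complex_norm_square [symmetric])

lemma cnj_nonneg: "0 \<le> (c::complex) \<Longrightarrow> cnj c = c"
  by (simp add: less_eq_complex_def complex_eq_iff)

text \<open>Needed after a factor |z - w|^2 has been divided out, when the sign is known only away
  from \<open>w\<close>: the points \<open>w * cis (1 / real (Suc k))\<close> stay on the circle,
  avoid \<open>w\<close> and tend to it.\<close>

lemma circle_closed_nonneg:
  fixes f :: "complex \<Rightarrow> complex"
  assumes cont: "isCont f w" and w: "cmod w = 1"
    and nonneg: "\<And>z. cmod z = 1 \<Longrightarrow> z \<noteq> w \<Longrightarrow> 0 \<le> f z"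
  shows "0 \<le> f w"
proof -
  define s where "s k = w * cis (1 / real (Suc k))" for k
  have "cis (1 / real (Suc k)) \<noteq> 1" for k
  proof -
    have "0 < sin (1 / real (Suc k))"
    proof (rule sin_gt_zero)
      have "1 / real (Suc k) \<le> 1"
        by simp
      then show "1 / real (Suc k) < pi"
        using pi_gt3 by linarith
    qed simp
    then show ?thesis
      by (auto simp: complex_eq_iff)
  qed
  then have "0 \<le> f (s k)" for k
    using w by (intro nonneg) (auto simp: s_def norm_mult)
  moreover have "(\<lambda>k. cis (1 / real (Suc k))) \<longlonglongrightarrow> cis 0"
    by (intro tendsto_cis LIMSEQ_Suc[OF lim_1_over_n])
  then have "s \<longlonglongrightarrow> w"
    unfolding s_def using tendsto_mult_left[of _ "1::complex" sequentially w] by simp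
  then have "(\<lambda>k. f (s k)) \<longlonglongrightarrow> f w"
    by (rule isCont_tendsto_compose[OF cont])
  moreover have "closed {c::complex. 0 \<le> c}"
    unfolding less_eq_complex_def by (intro closed_Collect_conj closed_Collect_le closed_Collect_eq continuous_intros)
  ultimately show ?thesis
    using closed_sequentially[of "{c. 0 \<le> c}" "\<lambda>k. f (s k)" "f w"] by simp
qed

text \<open>The reversal z^n cnj (p (1 / cnj z)), equal to z^n cnj (p z) on the circle; hence
  \<open>star n p * p\<close> encodes |p|^2. The bound \<open>n\<close> is explicit since
  \<open>degree p\<close> may be smaller.\<close>

definition star :: "nat \<Rightarrow> complex poly \<Rightarrow> complex poly" where
  "star n p = (\<Sum>k\<le>n. monom (cnj (coeff p k)) (n - k))"

lemma coeff_star: "coeff (star n p) k = (if k \<le> n then cnj (coeff p (n - k)) else 0)"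
proof -
  have "coeff (star n p) k = (\<Sum>i\<le>n. if n - i = k then cnj (coeff p i) else 0)"
    by (simp add: star_def coeff_sum)
  also have "\<dots> = (\<Sum>i\<le>n. if i = n - k then if k \<le> n then cnj (coeff p (n - k)) else 0 else 0)"
    by (intro sum.cong) auto
  also have "\<dots> = (if k \<le> n then cnj (coeff p (n - k)) else 0)"
    by (subst sum.delta) auto
  finally show ?thesis .
qed

lemma degree_star: "degree (star n p) \<le> n"
  by (rule degree_le) (simp add: coeff_star)

lemma star_add: "star n (p + q) = star n p + star n q"
  by (rule poly_eqI) (simp add: coeff_star)

lemma star_smult: "star n (smult c p) = smult (cnj c) (star n p)"
  by (rule poly_eqI) (simp add: coeff_star)

lemma poly_star:
  assumes "degree p \<le> n" "z \<noteq> 0"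
  shows "poly (star n p) z = z ^ n * cnj (poly p (1 / cnj z))"
proof -
  have "poly p w = (\<Sum>k\<le>n. coeff p k * w ^ k)" for w
    using assms(1) unfolding poly_altdef by (intro sum.mono_neutral_left) (auto simp: coeff_eq_0)
  then have "z ^ n * cnj (poly p (1 / cnj z)) = (\<Sum>k\<le>n. cnj (coeff p k) * (z ^ n / z ^ k))"
    by (simp add: sum_distrib_left mult_ac power_divide)
  also have "\<dots> = (\<Sum>k\<le>n. cnj (coeff p k) * z ^ (n - k))"
    using assms(2) by (intro sum.cong) (simp_all add: power_diff)
  also have "\<dots> = poly (star n p) z"
    by (simp add: star_def poly_sum poly_monom)
  finally show ?thesis ..
qed

lemma poly_star_circle:
  assumes "degree p \<le> n" "cmod z = 1"
  shows "poly (star n p) z = z ^ n * cnj (poly p z)"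
proof -
  have "z \<noteq> 0" "1 / cnj z = z"
    using assms(2) by (auto simp: cnj_eq_inverse_circle)
  then show ?thesis
    using poly_star[OF assms(1)] by simp
qed

text \<open>Values on the circle suffice, and there \<open>star\<close> is conjugation times a power
  of z, which is multiplicative; this avoids a convolution of reversed coefficients.\<close>

lemma star_mult:
  assumes "degree p \<le> m" "degree q \<le> n"
  shows "star (m + n) (p * q) = star m p * star n q"
proof (rule poly_eqI_circle)
  fix z :: complex assume z: "cmod z = 1"
  have "degree (p * q) \<le> m + n"
    using degree_mult_le[of p q] assms by linarith
  then show "poly (star (m + n) (p * q)) z = poly (star m p * star n q) z"
    using z assms by (simp add: poly_star_circle power_add)
qed

lemma star_mult_X:
  assumes "degree p \<le> n"
  shows "star (Suc n) (pCons 0 p) = star n p"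
  by (rule poly_eqI) (auto simp: coeff_star coeff_pCons Suc_diff_le coeff_eq_0 split: nat.splits)

lemma star_Suc:
  assumes "degree p \<le> n"
  shows "star (Suc n) p = pCons 0 (star n p)"
  using assms by (intro poly_eqI) (auto simp: coeff_star coeff_pCons coeff_eq_0 split: nat.splits)

lemma star_linear: "star 1 [:- w, 1:] = [:1, - cnj w:]"
  by (rule poly_eqI) (auto simp: coeff_star coeff_pCons split: nat.splits)

text \<open>A polynomial of degree at most \<open>2 n\<close> encodes the trigonometric polynomial
  \<open>z\<^sup>-\<^sup>n R(z)\<close> on the circle, where \<open>z\<^sup>-\<^sup>1 = cnj z\<close>.\<close>

definition trig_nonneg :: "nat \<Rightarrow> complex poly \<Rightarrow> bool" where
  "trig_nonneg n R \<longleftrightarrow> degree R \<le> 2 * n \<and> (\<forall>z. cmod z = 1 \<longrightarrow> 0 \<le> poly R z * cnj z ^ n)"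

lemma poly_star_mult_self:
  assumes "degree p \<le> n" "cmod z = 1"
  shows "poly (star n p * p) z * cnj z ^ n = complex_of_real ((cmod (poly p z))\<^sup>2)"
proof -
  have "poly (star n p * p) z * cnj z ^ n = (z * cnj z) ^ n * (poly p z * cnj (poly p z))"
    by (simp only: poly_mult poly_star_circle[OF assms] power_mult_distrib mult_ac)
  then show ?thesis
    by (simp only: mult_cnj_circle[OF assms(2)] complex_norm_square power_one mult_1)
qed

lemma degree_star_mult_self:
  assumes "degree p \<le> n"
  shows "degree (star n p * p) \<le> 2 * n"
  using degree_mult_le[of "star n p" p] degree_star[of n p] assms by linarith

lemma trig_nonneg_star_mult_self:
  assumes "degree p \<le> n"
  shows "trig_nonneg n (star n p * p)"
  unfolding trig_nonneg_def
proof (intro conjI allI impI)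
  fix z :: complex assume "cmod z = 1"
  then show "0 \<le> poly (star n p * p) z * cnj z ^ n"
    unfolding poly_star_mult_self[OF assms \<open>cmod z = 1\<close>] by (simp add: less_eq_complex_def)
qed (rule degree_star_mult_self[OF assms])

lemma trig_nonneg_smult: "trig_nonneg n R \<Longrightarrow> 0 \<le> c \<Longrightarrow> trig_nonneg n (smult (complex_of_real c) R)"
  by (auto simp: trig_nonneg_def less_eq_complex_def mult.assoc)

text \<open>Nonnegative values are real, so the trigonometric polynomial equals its own conjugate on
  the circle. Consequently the nonzero zeroes of \<open>R\<close> come in mirror pairs w, 1 / cnj
  w.\<close>

lemma star_trig_nonneg:
  assumes "trig_nonneg n R"
  shows "star (2 * n) R = R"
proof (rule poly_eqI_circle)
  fix z :: complex assume z: "cmod z = 1"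
  have "0 \<le> poly R z * cnj z ^ n"
    using assms z by (simp add: trig_nonneg_def)
  then have "cnj (poly R z * cnj z ^ n) = poly R z * cnj z ^ n"
    by (rule cnj_nonneg)
  then have "z ^ n * (z ^ n * cnj (poly R z)) = poly R z * (z * cnj z) ^ n"
    by (simp add: power_mult_distrib mult_ac)
  then show "poly (star (2 * n) R) z = poly R z"
    using assms z unfolding trig_nonneg_def
    by (simp add: poly_star_circle mult_cnj_circle mult_2 power_add mult.assoc)
qed

text \<open>A zero is a minimum of the nonnegative values along the circle, so the tangential
  derivative vanishes there.\<close>

lemma trig_nonneg_double_root:
  assumes R: "trig_nonneg n R" and w: "cmod w = 1" "poly R w = 0"
  shows "poly (pderiv R) w = 0"
proof -
  \<comment> \<open>For real \<open>x\<close> this is the nonnegative value at w exp(i x); writing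
    the conjugate as exp(- i x) makes \<open>G\<close> complex differentiable. In \<open>D\<close>
    the product rule has lost the term with the factor \<open>poly R w\<close>, which is 0.\<close>
  define G where "G x = poly R (w * exp (\<i> * x)) * (cnj w * exp (- \<i> * x)) ^ n" for x
  define D where "D = poly (pderiv R) w * (w * \<i>) * cnj w ^ n"
  have "(G has_field_derivative D) (at (of_real 0))"
    unfolding G_def D_def
    by (rule derivative_eq_intros DERIV_chain2[OF poly_DERIV] refl | simp add: w)+
  then have G: "((\<lambda>x. G (of_real x)) has_vector_derivative D) (at (0::real))"
    by (rule has_vector_derivative_real_field)
  have nonneg: "0 \<le> G (of_real x)" for x :: real
  proof -
    have "cmod (w * exp (\<i> * of_real x)) = 1"
      using w by (simp add: norm_mult)
    moreover have "cnj (w * exp (\<i> * of_real x)) = cnj w * exp (- \<i> * of_real x)"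
      by (simp add: exp_cnj)
    ultimately show ?thesis
      using R unfolding trig_nonneg_def G_def by metis
  qed
  have G0: "G 0 = 0"
    using w by (simp add: G_def)
  have "Re D = 0"
    by (rule DERIV_local_min[OF has_field_derivative_Re[OF G], of 1])
       (use nonneg G0 in \<open>auto simp: less_eq_complex_def\<close>)
  \<comment> \<open>On the real line the imaginary part of \<open>G\<close> is constantly 0, so
    every point is a minimum of it.\<close>
  moreover have "Im D = 0"
    by (rule DERIV_local_min[OF has_field_derivative_Im[OF G], of 1])
       (use nonneg G0 in \<open>auto simp: less_eq_complex_def\<close>)
  ultimately have "D = 0"
    by (simp add: complex_eq_iff)
  then show ?thesis
    using w by (auto simp: D_def)
qed

text \<open>The removed factor encodes |z - w|^2, which is positive for z \<noteq> w; if
  \<open>w\<close> lies on the circle, the value there follows by continuity.\<close>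

lemma trig_nonneg_cancel:
  assumes "trig_nonneg (Suc n) (star 1 [:- w, 1:] * [:- w, 1:] * S)" and S: "degree S \<le> 2 * n"
  shows "trig_nonneg n S"
  unfolding trig_nonneg_def
proof (intro conjI allI impI)
  fix z :: complex assume z: "cmod z = 1"
  have off: "0 \<le> poly S z * cnj z ^ n" if z: "cmod z = 1" and "z \<noteq> w" for z
  proof -
    have "0 \<le> poly (star 1 [:- w, 1:] * [:- w, 1:] * S) z * cnj z ^ Suc n"
      using assms(1) z unfolding trig_nonneg_def by blast
    also have "\<dots> = (poly (star 1 [:- w, 1:] * [:- w, 1:]) z * cnj z ^ 1) * (poly S z * cnj z ^ n)"
      by (simp only: poly_mult power_Suc power_0 mult_ac One_nat_def) simp
    also have "\<dots> = complex_of_real ((cmod (z - w))\<^sup>2) * (poly S z * cnj z ^ n)"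
      by (subst poly_star_mult_self) (use z in auto)
    finally have "0 \<le> complex_of_real ((cmod (z - w))\<^sup>2) * (poly S z * cnj z ^ n)" .
    moreover have "(cmod (z - w))\<^sup>2 > 0"
      using \<open>z \<noteq> w\<close> by simp
    ultimately show ?thesis
      by (simp add: less_eq_complex_def zero_le_mult_iff)
  qed
  have "isCont (\<lambda>z. poly S z * cnj z ^ n) w"
    by (intro continuous_intros)
  then show "0 \<le> poly S z * cnj z ^ n"
    using circle_closed_nonneg[of w "\<lambda>z. poly S z * cnj z ^ n"] off z by (cases "z = w") auto
qed (rule S)

text \<open>Splits off \<open>w\<close> together with its mirror image 1 / cnj w. Off the circle
  these are two different zeroes by the symmetry of \<open>R\<close>; on the circle they coincide,
  and the zero is double.\<close>

lemma trig_nonneg_factor: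
  assumes R: "trig_nonneg (Suc n) R" and w: "w \<noteq> 0" "poly R w = 0"
  obtains S where "R = star 1 [:- w, 1:] * [:- w, 1:] * S" "trig_nonneg n S"
proof -
  define u where "u = 1 / cnj w"
  obtain R1 where R1: "R = [:- w, 1:] * R1"
    using w(2) unfolding poly_eq_0_iff_dvd by (auto elim: dvdE)
  have "poly R1 u = 0"
  proof (cases "u = w")
    case True
    then have "w * cnj w = 1"
      using w by (simp add: u_def field_simps)
    then have "(cmod w)\<^sup>2 = 1"
      by (metis complex_norm_square of_real_eq_1_iff)
    then have "poly (pderiv R) w = 0"
      using trig_nonneg_double_root[OF R] w by (simp add: power2_eq_1_iff) (metis norm_ge_zero neg_0_le_iff_le not_one_le_zero)
    then show ?thesis
      unfolding True by (simp add: R1 pderiv_mult pderiv_pCons del: mult_pCons_left)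
  next
    case False
    have "poly R u = poly (star (2 * Suc n) R) u"
      by (simp only: star_trig_nonneg[OF R])
    also have "\<dots> = 0"
      using R w by (subst poly_star) (auto simp: u_def trig_nonneg_def)
    finally show ?thesis
      using False by (simp add: R1)
  qed
  then obtain R2 where R2: "R1 = [:- u, 1:] * R2"
    unfolding poly_eq_0_iff_dvd by (auto elim: dvdE)
  \<comment> \<open>Since 1 - cnj w z = - cnj w (z - u), the mirror factor is
    \<open>star 1 [:- w, 1:]\<close> up to this scalar.\<close>
  define S where "S = smult (- (1 / cnj w)) R2"
  have "[:- u, 1:] = smult (- (1 / cnj w)) (star 1 [:- w, 1:])"
    unfolding star_linear using w by (simp add: u_def)
  then have eq: "R = star 1 [:- w, 1:] * [:- w, 1:] * S"
    by (simp add: R1 R2 S_def mult_ac)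
  have "degree S \<le> 2 * n"
  proof (cases "R = 0")
    case True
    then have "R2 = 0"
      unfolding R1 R2 mult_eq_0_iff by simp
    then show ?thesis
      by (simp add: S_def)
  next
    case False
    then have "R2 \<noteq> 0"
      by (auto simp: R1 R2)
    then have "degree R = degree [:- w, 1:] + (degree [:- u, 1:] + degree R2)"
      by (simp only: R1 R2 degree_mult_eq mult_eq_0_iff pCons_eq_0_iff one_neq_zero simp_thms)
    then show ?thesis
      using R by (simp add: S_def trig_nonneg_def)
  qed
  then show thesis
    using that[OF eq] trig_nonneg_cancel R unfolding eq by blast
qed

text \<open>Induction on \<open>n\<close>: of each mirror pair of zeroes, one goes into
  \<open>p\<close>. If the constant coefficient vanishes, so does the one of top index by symmetry;
  the trigonometric polynomial then has lower degree and \<open>p\<close> is taken over unchanged.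
  Otherwise \<open>R\<close> has full degree, so it has a zero, and this zero is not 0.\<close>

lemma fejer_riesz:
  assumes "trig_nonneg n R"
  obtains p where "degree p \<le> n" "R = star n p * p"
  using assms
proof (induction n arbitrary: R thesis)
  case 0
  then obtain c where c: "R = [:c:]"
    by (auto simp: trig_nonneg_def elim: degree_eq_zeroE)
  have "0 \<le> poly R 1 * cnj 1 ^ 0"
    using 0(2) unfolding trig_nonneg_def by (metis norm_one)
  then have "0 \<le> c"
    by (simp add: c)
  then have "c = complex_of_real (sqrt (Re c)) * complex_of_real (sqrt (Re c))"
    by (simp add: less_eq_complex_def complex_eq_iff)
  moreover have "star 0 [:complex_of_real (sqrt (Re c)):] = [:complex_of_real (sqrt (Re c)):]"
    by (rule poly_eqI) (simp add: coeff_star coeff_pCons split: nat.splits)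
  ultimately show ?case
    by (intro 0(1)[of "[:complex_of_real (sqrt (Re c)):]"]) (simp_all add: c)
next
  case (Suc n)
  have deg: "degree R \<le> 2 * Suc n" and self: "star (2 * Suc n) R = R"
    using Suc.prems(2) star_trig_nonneg[OF Suc.prems(2)] unfolding trig_nonneg_def by blast+
  have end0: "coeff R (2 * Suc n) = cnj (coeff R 0)"
    by (subst self[symmetric]) (simp only: coeff_star, simp)
  show ?case
  proof (cases "coeff R 0 = 0")
    case True
    obtain S where S: "R = pCons 0 S"
      using True by (metis coeff_pCons_0 pCons_cases)
    have "coeff R i = 0" if "i > 2 * n + 1" for i
      using that end0 True deg by (cases "i = 2 * Suc n") (auto simp: coeff_eq_0)
    then have "degree S \<le> 2 * n"
      by (intro degree_le) (metis S Suc_eq_plus1 Suc_less_eq coeff_pCons_Suc)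
    moreover have "0 \<le> poly S z * cnj z ^ n" if "cmod z = 1" for z
    proof -
      have "poly R z * cnj z ^ Suc n = (z * cnj z) * (poly S z * cnj z ^ n)"
        by (simp add: S mult_ac)
      moreover have "0 \<le> poly R z * cnj z ^ Suc n"
        using Suc.prems(2) that unfolding trig_nonneg_def by blast
      ultimately show ?thesis
        by (simp only: mult_cnj_circle[OF that] mult_1)
    qed
    ultimately obtain p where p: "degree p \<le> n" "S = star n p * p"
      using Suc.IH[of S] by (auto simp: trig_nonneg_def)
    then show ?thesis
      by (intro Suc.prems(1)[of p]) (simp_all add: S star_Suc)
  next
    case False
    then have "degree R = 2 * Suc n"
      using end0 deg le_degree[of R "2 * Suc n"] by simp
    then obtain w where w: "poly R w = 0"
      using fundamental_theorem_of_algebra_alt[of R] by (metis degree_pCons_0 mult_is_0 nat.distinct(1) zero_neq_numeral)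
    moreover have "w \<noteq> 0"
      using w False by (auto simp: poly_0_coeff_0)
    ultimately obtain S where S: "R = star 1 [:- w, 1:] * [:- w, 1:] * S" "trig_nonneg n S"
      using trig_nonneg_factor[OF Suc.prems(2)] by metis
    obtain p where p: "degree p \<le> n" "S = star n p * p"
      using Suc.IH[OF _ S(2)] by blast
    have "star (1 + n) ([:- w, 1:] * p) = star 1 [:- w, 1:] * star n p"
      by (rule star_mult) (use p in auto)
    moreover have "degree ([:- w, 1:] * p) \<le> Suc n"
      using degree_mult_le[of "[:- w, 1:]" p] p by auto
    ultimately show ?thesis
      using S(1) p(2) by (intro Suc.prems(1)[of "[:- w, 1:] * p"]) (simp_all only: plus_1_eq_Suc mult_ac)
  qed
qed

section \<open>Functionals on the Toeplitz matrices\<close>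

text \<open>Pairs the symbol \<open>t\<close> with the trigonometric polynomial encoded by
  \<open>R\<close>: the coefficient of z^j has frequency j - n. Only the entries of \<open>t\<close>
  between -n and n enter.\<close>

definition tsum :: "nat \<Rightarrow> (int \<Rightarrow> complex) \<Rightarrow> complex poly \<Rightarrow> complex" where
  "tsum n t R = (\<Sum>j\<le>2 * n. coeff R j * t (int j - int n))"

lemma tsum_add: "tsum n t (R + S) = tsum n t R + tsum n t S"
  by (simp add: tsum_def distrib_right sum.distrib)

lemma tsum_smult: "tsum n t (smult c R) = c * tsum n t R"
  by (simp add: tsum_def sum_distrib_left mult.assoc)

lemma tsum_sum: "tsum n t (\<Sum>i\<in>I. R i) = (\<Sum>i\<in>I. tsum n t (R i))"
  by (induction I rule: infinite_finite_induct) (simp_all add: tsum_add, simp_all add: tsum_def)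

lemma tsum_monom: "j \<le> 2 * n \<Longrightarrow> tsum n t (monom c j) = c * t (int j - int n)"
  by (simp add: tsum_def if_distrib[of "\<lambda>x. x * _"] cong: if_cong)

lemma tsum_indicator:
  assumes "j \<le> 2 * n"
  shows "tsum n (\<lambda>i. if i = int j - int n then 1 else 0) R = coeff R j"
proof -
  have "tsum n (\<lambda>i. if i = int j - int n then 1 else 0) R = (\<Sum>i\<le>2 * n. if i = j then coeff R j else 0)"
    unfolding tsum_def by (intro sum.cong) auto
  then show ?thesis
    using assms by simp
qed

lemma tsum_cong:
  assumes "\<And>j. \<bar>j\<bar> \<le> int n \<Longrightarrow> s j = t j"
  shows "tsum n s R = tsum n t R"
  unfolding tsum_def by (intro sum.cong refl) (use assms in auto)

text \<open>The symbol \<open>z powi j\<close> belongs to the rank one matrix with entries z^k cnj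
  z^l, and pairing with it evaluates the trigonometric polynomial at \<open>z\<close>.\<close>

lemma tsum_powi:
  assumes "degree R \<le> 2 * n" "cmod z = 1"
  shows "tsum n (\<lambda>j. z powi j) R = poly R z * cnj z ^ n"
proof -
  have z: "z \<noteq> 0" "cnj z = inverse z"
    using assms(2) by (auto simp: cnj_eq_inverse_circle field_simps)
  have "poly R z = (\<Sum>j\<le>2 * n. coeff R j * z ^ j)"
    using assms(1) unfolding poly_altdef by (intro sum.mono_neutral_left) (auto simp: coeff_eq_0)
  moreover have "cnj z ^ n = inverse (z ^ n)"
    by (simp add: z power_inverse)
  ultimately show ?thesis
    using z(1) by (simp add: tsum_def power_int_diff sum_distrib_right divide_inverse mult.assoc)
qed

text \<open>The sesquilinear form of the Toeplitz matrix on polynomials of degree at most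
  \<open>n\<close>, antilinear in \<open>p\<close>. Written through \<open>star\<close>, it visibly
  depends only on the product of q and the conjugate of p on the circle.\<close>

definition tform :: "nat \<Rightarrow> (int \<Rightarrow> complex) \<Rightarrow> complex poly \<Rightarrow> complex poly \<Rightarrow> complex" where
  "tform n t p q = tsum n t (star n p * q)"

lemma tform_expand:
  assumes "degree q \<le> n"
  shows "tform n t p q = (\<Sum>k\<le>n. \<Sum>l\<le>n. cnj (coeff p k) * t (int l - int k) * coeff q l)"
proof -
  have "star n p * q = star n p * (\<Sum>l\<le>n. monom (coeff q l) l)"
    using assms by (simp add: poly_as_sum_of_monoms')
  also have "\<dots> = (\<Sum>k\<le>n. \<Sum>l\<le>n. monom (cnj (coeff p k) * coeff q l) (n - k + l))"
    by (simp add: star_def sum_product mult_monom)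
  finally have "tform n t p q =
      (\<Sum>k\<le>n. \<Sum>l\<le>n. tsum n t (monom (cnj (coeff p k) * coeff q l) (n - k + l)))"
    by (simp add: tform_def tsum_sum)
  also have "\<dots> = (\<Sum>k\<le>n. \<Sum>l\<le>n. cnj (coeff p k) * t (int l - int k) * coeff q l)"
    by (intro sum.cong refl) (simp add: tsum_monom of_nat_diff)
  finally show ?thesis .
qed

lemma tform_powi:
  assumes "degree p \<le> n" "degree q \<le> n" "cmod z = 1"
  shows "tform n (\<lambda>j. z powi j) p q = cnj (poly p z) * poly q z"
proof -
  have "degree (star n p * q) \<le> 2 * n"
    using degree_mult_le[of "star n p" q] degree_star[of n p] assms(2) by linarith
  then have "tform n (\<lambda>j. z powi j) p q = poly (star n p) z * poly q z * cnj z ^ n"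
    using assms by (simp add: tform_def tsum_powi)
  also have "\<dots> = (z * cnj z) ^ n * (cnj (poly p z) * poly q z)"
    using assms by (simp add: poly_star_circle power_mult_distrib)
  finally show ?thesis
    using assms by (simp add: mult_cnj_circle)
qed

section \<open>Toeplitz matrices and their symbols\<close>

lemma toeplitz_mat_dim [simp]:
  "dim_row (toeplitz_mat n t) = n" "dim_col (toeplitz_mat n t) = n" "toeplitz_mat n t \<in> carrier_mat n n"
  by (simp_all add: toeplitz_mat_def)

lemma toeplitz_mat_in_sys [simp]: "toeplitz_mat n t \<in> toeplitz_sys n"
  by (simp add: toeplitz_sys_def)

lemma toeplitz_mat_add: "toeplitz_mat n s + toeplitz_mat n t = toeplitz_mat n (\<lambda>j. s j + t j)"
  by (rule eq_matI) (simp_all add: toeplitz_mat_def)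

lemma toeplitz_mat_diff: "toeplitz_mat n s - toeplitz_mat n t = toeplitz_mat n (\<lambda>j. s j - t j)"
  by (rule eq_matI) (simp_all add: toeplitz_mat_def)

lemma toeplitz_mat_smult: "c \<cdot>\<^sub>m toeplitz_mat n t = toeplitz_mat n (\<lambda>j. c * t j)"
  by (rule eq_matI) (simp_all add: toeplitz_mat_def)

lemma toeplitz_mat_zero: "0\<^sub>m n n = toeplitz_mat n (\<lambda>_. 0)"
  by (rule eq_matI) (simp_all add: toeplitz_mat_def)

lemma toeplitz_mat_one: "1\<^sub>m n = toeplitz_mat n (\<lambda>j. if j = 0 then 1 else 0)"
  by (rule eq_matI) (simp_all add: toeplitz_mat_def)

definition symbol :: "complex Matrix.mat \<Rightarrow> int \<Rightarrow> complex" where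
  "symbol T j = (if 0 \<le> j then T $$ (nat j, 0) else T $$ (0, nat (- j)))"

lemma symbol_toeplitz_mat: "\<bar>j\<bar> \<le> int n \<Longrightarrow> symbol (toeplitz_mat (Suc n) t) j = t j"
  by (auto simp: symbol_def toeplitz_mat_def)

lemma toeplitz_mat_cong:
  assumes "\<And>j. \<bar>j\<bar> \<le> int n \<Longrightarrow> s j = t j"
  shows "toeplitz_mat (Suc n) s = toeplitz_mat (Suc n) t"
  using assms by (intro eq_matI) (simp_all add: toeplitz_mat_def)

lemma toeplitz_mat_eq_iff:
  "toeplitz_mat (Suc n) s = toeplitz_mat (Suc n) t \<longleftrightarrow> (\<forall>j. \<bar>j\<bar> \<le> int n \<longrightarrow> s j = t j)"
  using toeplitz_mat_cong symbol_toeplitz_mat by metis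

lemma coeff_vec_poly: "coeff (vec_poly n v) k = (if k \<le> n then vec_index v (n - k) else 0)"
proof -
  have "coeff (vec_poly n v) k = (\<Sum>i\<le>n. if n - i = k then vec_index v i else 0)"
    by (simp add: vec_poly_def coeff_sum)
  also have "\<dots> = (\<Sum>i\<le>n. if i = n - k then if k \<le> n then vec_index v (n - k) else 0 else 0)"
    by (intro sum.cong) auto
  also have "\<dots> = (if k \<le> n then vec_index v (n - k) else 0)"
    by (subst sum.delta) auto
  finally show ?thesis .
qed

lemma degree_vec_poly: "degree (vec_poly n v) \<le> n"
  by (rule degree_le) (simp add: coeff_vec_poly)

lemma vec_poly_surj:
  assumes "degree p \<le> n"
  obtains v where "v \<in> carrier_vec (Suc n)" "vec_poly n v = p"
proof
  show "vec_poly n (Matrix.vec (Suc n) (\<lambda>k. coeff p (n - k))) = p"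
    using assms by (intro poly_eqI) (auto simp: coeff_vec_poly coeff_eq_0)
qed simp

text \<open>\<open>tform\<close> pairs the coefficients k and l with t (l - k), while the matrix
  entry is t (k - l). Since \<open>vec_poly\<close> lists the entries of \<open>v\<close> from the
  top degree down, replacing k by n - k and l by n - l reconciles the two.\<close>

lemma hinner_toeplitz_mat:
  assumes "v \<in> carrier_vec (Suc n)"
  shows "hinner v (toeplitz_mat (Suc n) t *\<^sub>v v) = tform n t (vec_poly n v) (vec_poly n v)"
proof -
  have rev: "(\<Sum>k<Suc n. g k) = (\<Sum>k<Suc n. g (n - k))" for g :: "nat \<Rightarrow> complex"
    using sum.nat_diff_reindex[of g "Suc n"] by simp
  have rev2: "(\<Sum>k<Suc n. \<Sum>l<Suc n. G k l) = (\<Sum>k<Suc n. \<Sum>l<Suc n. G (n - k) (n - l))"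
    for G :: "nat \<Rightarrow> nat \<Rightarrow> complex"
    by (rule trans[OF rev sum.cong[OF refl rev]])
  have "hinner v (toeplitz_mat (Suc n) t *\<^sub>v v) =
      (\<Sum>k<Suc n. \<Sum>l<Suc n. cnj (vec_index v k) * t (int k - int l) * vec_index v l)"
    using assms by (simp add: hinner_def scalar_prod_def toeplitz_mat_def sum_distrib_left
        sum_distrib_right mult_ac atLeast0LessThan del: sum.lessThan_Suc)
  also have "\<dots> = (\<Sum>k<Suc n. \<Sum>l<Suc n. cnj (vec_index v (n - k)) * t (int (n - k) - int (n - l)) * vec_index v (n - l))"
    by (rule rev2)
  also have "\<dots> = tform n t (vec_poly n v) (vec_poly n v)"
    unfolding tform_expand[OF degree_vec_poly] lessThan_Suc_atMost
    by (intro sum.cong refl) (simp add: coeff_vec_poly of_nat_diff)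
  finally show ?thesis .
qed

lemma toeplitz_cone_iff:
  "toeplitz_mat (Suc n) t \<in> toeplitz_cone (Suc n) \<longleftrightarrow> (\<forall>p. degree p \<le> n \<longrightarrow> 0 \<le> tform n t p p)"
proof -
  have "(\<forall>v \<in> carrier_vec (Suc n). 0 \<le> tform n t (vec_poly n v) (vec_poly n v)) \<longleftrightarrow>
      (\<forall>p. degree p \<le> n \<longrightarrow> 0 \<le> tform n t p p)"
    using degree_vec_poly vec_poly_surj by metis
  then show ?thesis
    by (simp add: toeplitz_cone_def psd_def hinner_toeplitz_mat)
qed

lemma toeplitz_sysE:
  assumes "T \<in> toeplitz_sys n"
  obtains t where "T = toeplitz_mat n t"
  using assms by (auto simp: toeplitz_sys_def)

lemma toeplitz_coneE:
  assumes "T \<in> toeplitz_cone n"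
  obtains t where "T = toeplitz_mat n t"
  using assms by (auto simp: toeplitz_cone_def elim: toeplitz_sysE)

text \<open>Coordinates for the dual: each functional arises from exactly one \<open>R\<close> of
  degree at most 2 n, so states can be treated as polynomials.\<close>

definition functional :: "nat \<Rightarrow> complex poly \<Rightarrow> complex Matrix.mat \<Rightarrow> complex" where
  "functional n R = (\<lambda>T \<in> toeplitz_sys (Suc n). tsum n (symbol T) R)"

lemma functional_toeplitz_mat: "functional n R (toeplitz_mat (Suc n) t) = tsum n t R"
  using tsum_cong[of n "symbol (toeplitz_mat (Suc n) t)" t R]
  by (simp add: functional_def symbol_toeplitz_mat)

lemma functional_eqI:
  assumes "\<phi> \<in> extensional (toeplitz_sys (Suc n))"
    and "\<And>t. \<phi> (toeplitz_mat (Suc n) t) = tsum n t R"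
  shows "\<phi> = functional n R"
proof (rule extensionalityI[OF assms(1)])
  show "functional n R \<in> extensional (toeplitz_sys (Suc n))"
    by (simp add: functional_def)
  fix T assume "T \<in> toeplitz_sys (Suc n)"
  then show "\<phi> T = functional n R T"
    by (auto elim!: toeplitz_sysE simp: assms(2) functional_toeplitz_mat)
qed

lemma functional_in_dual: "functional n R \<in> dual (Suc n)"
  unfolding dual_def
proof (intro CollectI conjI ballI allI)
  show "functional n R \<in> extensional (toeplitz_sys (Suc n))"
    by (simp add: functional_def)
  fix S T assume "S \<in> toeplitz_sys (Suc n)" "T \<in> toeplitz_sys (Suc n)"
  then show "functional n R (S + T) = functional n R S + functional n R T"
    by (auto elim!: toeplitz_sysE simp: toeplitz_mat_add functional_toeplitz_mat tsum_def
        distrib_left sum.distrib)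
next
  fix c T assume "T \<in> toeplitz_sys (Suc n)"
  then show "functional n R (c \<cdot>\<^sub>m T) = c * functional n R T"
    by (auto elim!: toeplitz_sysE simp: toeplitz_mat_smult functional_toeplitz_mat tsum_def
        sum_distrib_left mult_ac)
qed

lemma functional_inject:
  assumes "degree R \<le> 2 * n" "degree S \<le> 2 * n" "functional n R = functional n S"
  shows "R = S"
proof (rule poly_eqI)
  fix j
  show "coeff R j = coeff S j"
  proof (cases "j \<le> 2 * n")
    case True
    show ?thesis
      using functional_toeplitz_mat[of n _ "\<lambda>i. if i = int j - int n then 1 else 0"] assms(3)
      by (metis tsum_indicator[OF True])
  qed (use assms in \<open>simp add: coeff_eq_0\<close>)
qed

lemma dual_functional:
  assumes \<phi>: "\<phi> \<in> dual (Suc n)"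
  obtains R where "degree R \<le> 2 * n" "\<phi> = functional n R"
proof -
  \<comment> \<open>The matrices with these one-frequency symbols span the system; the values of
    \<open>\<phi>\<close> on them are the coefficients of \<open>R\<close>.\<close>
  define e :: "nat \<Rightarrow> int \<Rightarrow> complex" where "e j = (\<lambda>i. if i = int j - int n then 1 else 0)" for j
  define R where "R = (\<Sum>j\<le>2 * n. monom (\<phi> (toeplitz_mat (Suc n) (e j))) j)"
  have coeff_R: "coeff R j = (if j \<le> 2 * n then \<phi> (toeplitz_mat (Suc n) (e j)) else 0)" for j
    by (simp add: R_def coeff_sum)
  have add: "\<phi> (toeplitz_mat (Suc n) (\<lambda>i. s i + t i)) = \<phi> (toeplitz_mat (Suc n) s) + \<phi> (toeplitz_mat (Suc n) t)" for s t
    using \<phi> unfolding dual_def toeplitz_mat_add[symmetric] by simp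
  have smult: "\<phi> (toeplitz_mat (Suc n) (\<lambda>i. c * t i)) = c * \<phi> (toeplitz_mat (Suc n) t)" for c t
    using \<phi> unfolding dual_def toeplitz_mat_smult[symmetric] by simp
  have sum: "\<phi> (toeplitz_mat (Suc n) (\<lambda>i. \<Sum>j\<in>F. c j * e j i)) = (\<Sum>j\<in>F. c j * \<phi> (toeplitz_mat (Suc n) (e j)))"
    if "finite F" for F c
    using that
  proof (induction F)
    case empty
    then show ?case
      using smult[of 0 "\<lambda>_. 0"] by simp
  next
    case (insert x F)
    then show ?case
      using add[of "\<lambda>i. c x * e x i" "\<lambda>i. \<Sum>j\<in>F. c j * e j i"] smult by simp
  qed
  have "\<phi> (toeplitz_mat (Suc n) t) = tsum n t R" for t
  proof -
    have "t i = (\<Sum>j\<le>2 * n. t (int j - int n) * e j i)" if "\<bar>i\<bar> \<le> int n" for i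
    proof -
      have "(\<Sum>j\<le>2 * n. t (int j - int n) * e j i) = (\<Sum>j\<le>2 * n. if j = nat (i + int n) then t i else 0)"
        using that by (intro sum.cong) (auto simp: e_def)
      then show ?thesis
        using that by simp
    qed
    then have "toeplitz_mat (Suc n) t = toeplitz_mat (Suc n) (\<lambda>i. \<Sum>j\<le>2 * n. t (int j - int n) * e j i)"
      by (rule toeplitz_mat_cong)
    then have "\<phi> (toeplitz_mat (Suc n) t) =
        (\<Sum>j\<le>2 * n. t (int j - int n) * \<phi> (toeplitz_mat (Suc n) (e j)))"
      using sum[of "{..2 * n}" "\<lambda>j. t (int j - int n)"] by simp
    then show ?thesis
      by (simp add: tsum_def coeff_R mult.commute)
  qed
  then have "\<phi> = functional n R"
    using \<phi> by (intro functional_eqI) (auto simp: dual_def)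
  moreover have "degree R \<le> 2 * n"
    by (rule degree_le) (simp add: coeff_R)
  ultimately show thesis
    using that by blast
qed

lemma functional_one: "functional n R (1\<^sub>m (Suc n)) = coeff R n"
  unfolding toeplitz_mat_one functional_toeplitz_mat
  using tsum_indicator[of n n R] by simp

text \<open>Necessity uses only the rank one matrices with symbol \<open>z powi j\<close>, on which
  the functional takes the values of the trigonometric polynomial. For sufficiency,
  \<open>fejer_riesz\<close> turns the pairing into the form at \<open>p\<close>. The unit has
  frequency 0 only, which selects the middle coefficient.\<close>

lemma functional_state_iff:
  assumes "degree R \<le> 2 * n"
  shows "functional n R \<in> state_space (Suc n) \<longleftrightarrow> trig_nonneg n R \<and> coeff R n = 1"
proof -
  have "trig_nonneg n R" if pos: "\<forall>T \<in> toeplitz_cone (Suc n). 0 \<le> functional n R T"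
    unfolding trig_nonneg_def
  proof (intro conjI allI impI)
    fix z :: complex assume z: "cmod z = 1"
    have "toeplitz_mat (Suc n) (\<lambda>j. z powi j) \<in> toeplitz_cone (Suc n)"
      unfolding toeplitz_cone_iff using z by (simp add: tform_powi less_eq_complex_def)
    then have "0 \<le> functional n R (toeplitz_mat (Suc n) (\<lambda>j. z powi j))"
      using pos by blast
    then show "0 \<le> poly R z * cnj z ^ n"
      using assms z by (simp add: functional_toeplitz_mat tsum_powi)
  qed (rule assms)
  moreover have "0 \<le> functional n R T" if R: "trig_nonneg n R" and T: "T \<in> toeplitz_cone (Suc n)" for T
  proof -
    obtain t where t: "T = toeplitz_mat (Suc n) t"
      using T by (rule toeplitz_coneE)
    obtain p where p: "degree p \<le> n" "R = star n p * p"
      using R by (rule fejer_riesz)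
    have "0 \<le> tform n t p p"
      using T p unfolding t toeplitz_cone_iff by blast
    then show ?thesis
      by (simp add: t functional_toeplitz_mat p(2) tform_def)
  qed
  ultimately show ?thesis
    using functional_in_dual functional_one by (auto simp: state_space_def)
qed

lemma vector_functional_eq:
  assumes "v \<in> carrier_vec (Suc n)"
  shows "vector_functional (Suc n) v = functional n (star n (vec_poly n v) * vec_poly n v)"
proof (rule functional_eqI)
  show "vector_functional (Suc n) v \<in> extensional (toeplitz_sys (Suc n))"
    by (simp add: vector_functional_def)
qed (use assms in \<open>simp add: vector_functional_def hinner_toeplitz_mat tform_def\<close>)

lemma hinner_self_eq:
  assumes "v \<in> carrier_vec (Suc n)"
  shows "hinner v v = coeff (star n (vec_poly n v) * vec_poly n v) n"
proof -
  have one_in_sys: "1\<^sub>m (Suc n) \<in> toeplitz_sys (Suc n)"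
    by (simp add: toeplitz_mat_one)
  have "hinner v v = vector_functional (Suc n) v (1\<^sub>m (Suc n))"
    using assms one_in_sys by (simp add: vector_functional_def)
  then show ?thesis
    by (simp add: vector_functional_eq[OF assms] functional_one)
qed

section \<open>Extreme rays\<close>

lemma tform_add_left: "tform n t (p + q) r = tform n t p r + tform n t q r"
  by (simp add: tform_def star_add distrib_right tsum_add)

lemma tform_add_right: "tform n t p (q + r) = tform n t p q + tform n t p r"
  by (simp add: tform_def distrib_left tsum_add)

lemma tform_smult_left: "tform n t (smult c p) q = cnj c * tform n t p q"
  by (simp add: tform_def star_smult tsum_smult)

lemma tform_smult_right: "tform n t p (smult c q) = c * tform n t p q"
  by (simp add: tform_def tsum_smult)

lemma tform_minus_left: "tform n t (- p) q = - tform n t p q"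
  using tform_smult_left[of n t "-1" p q] by simp

lemma tform_minus_right: "tform n t p (- q) = - tform n t p q"
  using tform_smult_right[of n t p "-1" q] by simp

lemma tform_diff_left: "tform n t (p - q) r = tform n t p r - tform n t q r"
  using tform_add_left[of n t p "- q" r] by (simp add: tform_minus_left)

lemma tform_diff_right: "tform n t p (q - r) = tform n t p q - tform n t p r"
  using tform_add_right[of n t p q "- r"] by (simp add: tform_minus_right)

lemma tform_0_left [simp]: "tform n t 0 q = 0"
  using tform_smult_left[of n t 0 0 q] by simp

lemma tform_0_right [simp]: "tform n t p 0 = 0"
  using tform_smult_right[of n t p 0 0] by simp

lemmas tform_simps = tform_add_left tform_add_right tform_smult_left tform_smult_right
  tform_diff_left tform_diff_right

lemma tform_scale: "tform n (\<lambda>j. c * t j) p q = c * tform n t p q"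
  by (simp add: tform_def tsum_def sum_distrib_left mult_ac)

lemma tform_diff_symbol: "tform n (\<lambda>j. s j - t j) p q = tform n s p q - tform n t p q"
  by (simp add: tform_def tsum_def algebra_simps sum_subtractf)

lemma tform_monom:
  assumes "k \<le> n" "l \<le> n"
  shows "tform n t (monom 1 k) (monom 1 l) = t (int l - int k)"
proof -
  have "star n (monom 1 k) = monom 1 (n - k)"
    using assms by (intro poly_eqI) (auto simp: coeff_star)
  then show ?thesis
    using assms by (simp add: tform_def mult_monom tsum_monom of_nat_diff)
qed

lemma tform_one: "tform n t 1 1 = t 0"
  using tform_monom[of 0 n 0 t] by (simp add: monom_0 one_pCons)

text \<open>The Toeplitz property: multiplication by z is isometric, because z cnj z = 1 on the
  circle leaves \<open>star n p * q\<close> unchanged. The strict bounds keep the shifted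
  polynomials within degree \<open>n\<close>.\<close>

lemma tform_shift:
  assumes "degree p < n" "degree q < n"
  shows "tform n t (pCons 0 p) (pCons 0 q) = tform n t p q"
proof -
  obtain m where m: "n = Suc m"
    using assms by (cases n) auto
  have "star n (pCons 0 p) = star m p" "star n p = pCons 0 (star m p)"
    using assms by (simp_all add: m star_mult_X star_Suc)
  then show ?thesis
    by (simp add: tform_def)
qed

text \<open>The discriminant argument behind Cauchy-Schwarz, with \<open>b\<close> in the role of |F
  p q|^2. For c > 0 the minimizer is r = 1 / c; for c = 0 the expression is affine in r and, unless
  b = 0, takes the value -1 at the chosen r.\<close>

lemma quadratic_nonneg_imp_le:
  fixes a b c :: real
  assumes "\<And>r. 0 \<le> a - 2 * r * b + r\<^sup>2 * b * c" "0 \<le> b" "0 \<le> c"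
  shows "b \<le> a * c"
proof (cases "c = 0")
  case True
  have "b = 0"
  proof (rule ccontr)
    assume "b \<noteq> 0"
    then show False
      using assms(1)[of "(a + 1) / (2 * b)"] True by (simp add: field_simps)
  qed
  then show ?thesis
    using True by simp
next
  case False
  then show ?thesis
    using assms(1)[of "1 / c"] assms(3) by (simp add: field_simps power2_eq_square)
qed

locale toeplitz_psd =
  fixes n :: nat and t :: "int \<Rightarrow> complex"
  assumes nonneg: "degree p \<le> n \<Longrightarrow> 0 \<le> tform n t p p"
begin

abbreviation F where "F \<equiv> tform n t"

lemma form_self: "degree p \<le> n \<Longrightarrow> F p p = complex_of_real (Re (F p p))"
  using nonneg[of p] by (simp add: less_eq_complex_def complex_eq_iff)

text \<open>Polarization: positivity makes the values at \<open>p + q\<close> and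
  \<open>p + smult \<i> q\<close> real. The symmetry of the symbol is thus a consequence of
  positivity.\<close>

lemma hermitian:
  assumes "degree p \<le> n" "degree q \<le> n"
  shows "F q p = cnj (F p q)"
proof -
  have "Im (F (p + q) (p + q)) = 0" "Im (F (p + smult \<i> q) (p + smult \<i> q)) = 0"
    using assms by (auto intro!: form_self[THEN arg_cong[where f = Im], simplified] degree_add_le)
  moreover have "Im (F p p) = 0" "Im (F q q) = 0"
    using form_self[of p] form_self[of q] assms by (metis Im_complex_of_real)+
  ultimately show ?thesis
    by (simp add: tform_simps complex_eq_iff)
qed

lemma cauchy_schwarz:
  assumes "degree p \<le> n" "degree q \<le> n"
  shows "(cmod (F p q))\<^sup>2 \<le> Re (F p p) * Re (F q q)"
proof (rule quadratic_nonneg_imp_le)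
  fix r :: real
  \<comment> \<open>The factor \<open>cnj (F p q)\<close> makes both cross terms equal to - r |F p
    q|^2.\<close>
  define s where "s = - complex_of_real r * cnj (F p q)"
  have "degree (p + smult s q) \<le> n"
    using assms by (intro degree_add_le) auto
  then have "0 \<le> Re (F (p + smult s q) (p + smult s q))"
    using nonneg by (simp add: less_eq_complex_def)
  also have "F (p + smult s q) (p + smult s q) =
      F p p - complex_of_real (2 * r * (cmod (F p q))\<^sup>2) + complex_of_real (r\<^sup>2 * (cmod (F p q))\<^sup>2) * F q q"
    unfolding of_real_mult complex_norm_square
    by (simp add: tform_simps s_def hermitian[OF assms] power2_eq_square algebra_simps)
  finally show "0 \<le> Re (F p p) - 2 * r * (cmod (F p q))\<^sup>2 + r\<^sup>2 * (cmod (F p q))\<^sup>2 * Re (F q q)"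
    by (simp del: of_real_power of_real_mult)
qed (use nonneg[OF assms(2)] in \<open>simp_all add: less_eq_complex_def\<close>)

lemma null_right:
  assumes "degree p \<le> n" "degree q \<le> n" "F q q = 0"
  shows "F p q = 0"
  using cauchy_schwarz[OF assms(1,2)] assms(3) by simp

lemma null_left:
  assumes "degree p \<le> n" "degree q \<le> n" "F q q = 0"
  shows "F q p = 0"
  using hermitian[OF assms(1,2)] null_right[OF assms] by simp

lemma null_add:
  assumes "degree p \<le> n" "degree q \<le> n" "F p p = 0" "F q q = 0"
  shows "F (p + q) (p + q) = 0"
  using assms null_right[of p q] null_right[of q p] by (simp add: tform_simps)

text \<open>Follows the Horner form of \<open>q\<close>: null polynomials are closed under sums by
  Cauchy-Schwarz, and under the isometric shift as long as the degree leaves room for it.\<close>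

lemma null_mult:
  assumes "F p p = 0" "degree p + degree q \<le> n"
  shows "F (p * q) (p * q) = 0"
  using assms(2)
proof (induction q)
  case (pCons a q)
  show ?case
  proof (cases "q = 0")
    case True
    then show ?thesis
      using assms(1) by (simp add: tform_simps)
  next
    case False
    then have q: "degree p + degree q < n"
      using pCons.prems by simp
    then have deg: "degree (p * q) < n"
      using degree_mult_le[of p q] by linarith
    then have "F (pCons 0 (p * q)) (pCons 0 (p * q)) = 0"
      using pCons.IH q by (simp add: tform_shift)
    moreover have "degree (pCons 0 (p * q)) \<le> n"
      using deg degree_pCons_le[of 0 "p * q"] by linarith
    moreover have "F (smult a p) (smult a p) = 0" "degree (smult a p) \<le> n"
      using assms(1) q by (auto simp: tform_simps)
    ultimately have "F (smult a p + pCons 0 (p * q)) (smult a p + pCons 0 (p * q)) = 0"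
      by (intro null_add) auto
    then show ?thesis
      by simp
  qed
qed simp

text \<open>Riesz representation on the polynomials of degree less than \<open>d\<close>, where the form is
  assumed to be definite, by Gram-Schmidt.\<close>

lemma representer:
  assumes add: "\<And>p q. f (p + q) = f p + f q" and smult: "\<And>c p. f (smult c p) = c * f p"
    and definite: "\<And>r. r \<noteq> 0 \<Longrightarrow> \<forall>i\<ge>d. coeff r i = 0 \<Longrightarrow> F r r \<noteq> 0"
  shows "\<exists>u. (\<forall>i\<ge>d. coeff u i = 0) \<and> (\<forall>r. (\<forall>i\<ge>d. coeff r i = 0) \<longrightarrow> f r = F u r)"
  using assms
proof (induction d arbitrary: f)
  case 0
  have "f 0 = 0"
    using 0(2)[of 0 0] by simp
  moreover have "r = 0" if "\<forall>i. coeff r i = 0" for r :: "complex poly"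
    using that by (intro poly_eqI) simp
  ultimately show ?case
    by (intro exI[of _ 0]) auto
next
  case (Suc d)
  have definite: "F r r \<noteq> 0" if "r \<noteq> 0" "\<forall>i\<ge>d. coeff r i = 0" for r
    using Suc.prems(3) that by simp
  obtain u where u: "\<forall>i\<ge>d. coeff u i = 0" "\<And>r. \<forall>i\<ge>d. coeff r i = 0 \<Longrightarrow> f r = F u r"
    using Suc.IH[OF Suc.prems(1,2) definite] by blast
  \<comment> \<open>This second use of the induction hypothesis is why the functional is kept
    arbitrary: \<open>u'\<close> represents pairing with z^d on lower degrees, so that
    \<open>e\<close> is monic of degree \<open>d\<close> and orthogonal to all of them.\<close>
  obtain u' where u': "\<forall>i\<ge>d. coeff u' i = 0" "\<And>r. \<forall>i\<ge>d. coeff r i = 0 \<Longrightarrow> F (monom 1 d) r = F u' r"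
    using Suc.IH[of "F (monom 1 d)", OF tform_add_right tform_smult_right definite] by blast
  define e where "e = monom 1 d - u'"
  have e: "coeff e d = 1" "\<forall>i\<ge>Suc d. coeff e i = 0"
    using u'(1) by (simp_all add: e_def)
  have e_orth: "F e r = 0" if "\<forall>i\<ge>d. coeff r i = 0" for r
    using u'(2)[OF that] by (simp add: e_def tform_simps)
  have "F e e \<noteq> 0"
    using e by (intro Suc.prems(3)) auto
  \<comment> \<open>Adding a multiple of \<open>e\<close> does not disturb the lower degrees;
    \<open>\<alpha>\<close> corrects the value at \<open>e\<close>, conjugated because the form is
    antilinear on the left.\<close>
  define \<alpha> where "\<alpha> = cnj ((f e - F u e) / F e e)"
  then have fe: "f e = F u e + cnj \<alpha> * F e e"
    using \<open>F e e \<noteq> 0\<close> by simp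
  define U where "U = u + smult \<alpha> e"
  have "\<forall>i\<ge>Suc d. coeff U i = 0"
    using u(1) e(2) by (simp add: U_def)
  moreover have "f r = F U r" if r: "\<forall>i\<ge>Suc d. coeff r i = 0" for r
  proof -
    define r0 where "r0 = r - smult (coeff r d) e"
    have r0: "\<forall>i\<ge>d. coeff r0 i = 0"
    proof (intro allI impI)
      fix i assume "d \<le> i"
      then show "coeff r0 i = 0"
        using e r by (cases "i = d") (auto simp: r0_def)
    qed
    have r_eq: "r = r0 + smult (coeff r d) e"
      by (simp add: r0_def)
    have "f r = F u r0 + coeff r d * f e"
      using Suc.prems(1)[of r0 "smult (coeff r d) e"] Suc.prems(2) u(2)[OF r0] r_eq by simp
    also have "\<dots> = F U (r0 + smult (coeff r d) e)"
      using e_orth[OF r0] by (simp add: U_def tform_simps fe algebra_simps)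
    finally show ?thesis
      using r_eq by simp
  qed
  ultimately show ?case
    by blast
qed

text \<open>A point of the circle at which all null polynomials vanish: a zero of a null polynomial
  \<open>(z - w) q\<close> of minimal degree satisfies \<open>F q q = F (z q) (z q) = \<bar>w\<bar>\<^sup>2 F q q\<close>, because
  multiplication by \<open>z\<close> is isometric.\<close>

lemma evaluation_representer:
  assumes t0: "t 0 \<noteq> 0"
  obtains w u where "cmod w = 1" "degree u \<le> n" "\<And>v. degree v \<le> n \<Longrightarrow> poly v w = F u v"
proof (cases "\<exists>p. p \<noteq> 0 \<and> degree p \<le> n \<and> F p p = 0")
  case False
  \<comment> \<open>Here the form is definite, so every evaluation has a representer; the point 1 is
    an arbitrary choice on the circle.\<close>
  have "\<exists>u. (\<forall>i\<ge>Suc n. coeff u i = 0) \<and> (\<forall>r. (\<forall>i\<ge>Suc n. coeff r i = 0) \<longrightarrow> poly r 1 = F u r)"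
  proof (rule representer)
    fix r :: "complex poly" assume "r \<noteq> 0" "\<forall>i\<ge>Suc n. coeff r i = 0"
    moreover from this have "degree r \<le> n"
      by (intro degree_le) auto
    ultimately show "F r r \<noteq> 0"
      using False by blast
  qed simp_all
  then obtain u where u: "\<forall>i\<ge>Suc n. coeff u i = 0" "\<And>r. \<forall>i\<ge>Suc n. coeff r i = 0 \<Longrightarrow> poly r 1 = F u r"
    by blast
  have "degree u \<le> n"
    using u(1) by (intro degree_le) auto
  moreover have "poly v 1 = F u v" if "degree v \<le> n" for v
    using that by (intro u(2)) (auto simp: coeff_eq_0)
  ultimately show thesis
    using that[of 1 u] by simp
next
  case True
  then obtain p where p: "p \<noteq> 0" "degree p \<le> n" "F p p = 0"
    and least: "\<And>q. q \<noteq> 0 \<Longrightarrow> degree q \<le> n \<Longrightarrow> F q q = 0 \<Longrightarrow> degree p \<le> degree q"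
    using ex_has_least_nat[of "\<lambda>p. p \<noteq> 0 \<and> degree p \<le> n \<and> F p p = 0" _ degree] by metis
  have "degree p \<noteq> 0"
  proof
    assume "degree p = 0"
    then obtain c where "p = [:c:]"
      by (rule degree_eq_zeroE)
    then have c: "p = smult c 1"
      by (simp add: one_pCons)
    then have "F p p = c * (cnj c * t 0)"
      by (simp only: tform_simps tform_one)
    then show False
      using p(1,3) t0 c by auto
  qed
  then have "\<not> constant (poly p)"
    by (simp add: constant_degree)
  then obtain w where w: "poly p w = 0"
    using fundamental_theorem_of_algebra by blast
  then obtain q where q: "p = [:- w, 1:] * q"
    unfolding poly_eq_0_iff_dvd by (auto elim: dvdE)
  have "q \<noteq> 0"
    using p q by auto
  then have "degree p = degree [:- w, 1:] + degree q"
    unfolding q by (intro degree_mult_eq) auto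
  then have deg_q: "degree p = Suc (degree q)"
    by simp
  define q' where "q' = pCons 0 q"
  have deg: "degree q \<le> n" "degree q' \<le> n"
    using deg_q p(2) \<open>q \<noteq> 0\<close> by (auto simp: q'_def)
  have p_eq: "p = q' - smult w q"
    by (simp add: q q'_def)
  have "F q q \<noteq> 0"
    using least[OF \<open>q \<noteq> 0\<close> deg(1)] deg_q by auto
  \<comment> \<open>Being null, \<open>p\<close> is orthogonal to everything of degree at most
    \<open>n\<close>, so \<open>q'\<close> may be replaced by w q on the left of the form, which
    produces \<open>cnj w\<close>.\<close>
  have "F p q' = 0" "F p q = 0"
    using null_left p deg by auto
  then have "F q' q' = cnj w * F q q'" "F q' q = cnj w * F q q"
    by (simp_all add: p_eq tform_simps)
  moreover have "F q' q' = F q q"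
    unfolding q'_def using deg_q p(2) by (intro tform_shift) auto
  moreover have "F q q' = cnj (F q' q)" "F q q = cnj (F q q)"
    using hermitian deg by blast+
  ultimately have "F q q = cnj w * w * F q q"
    by (metis complex_cnj_cnj complex_cnj_mult mult.assoc)
  then have "w * cnj w = 1"
    using \<open>F q q \<noteq> 0\<close> by (simp add: mult.commute[of w])
  then have "(cmod w)\<^sup>2 = 1"
    by (metis complex_norm_square of_real_eq_1_iff)
  then have w1: "cmod w = 1"
    by (simp add: power2_eq_1_iff) (metis norm_ge_zero neg_0_le_iff_le not_one_le_zero)
  have "\<exists>u. (\<forall>i\<ge>degree p. coeff u i = 0) \<and> (\<forall>r. (\<forall>i\<ge>degree p. coeff r i = 0) \<longrightarrow> poly r w = F u r)"
  proof (rule representer)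
    fix r :: "complex poly" assume r: "r \<noteq> 0" "\<forall>i\<ge>degree p. coeff r i = 0"
    then have "degree r < degree p"
      by (metis leading_coeff_0_iff not_le)
    then show "F r r \<noteq> 0"
      using least[OF r(1)] p(2) by fastforce
  qed simp_all
  then obtain u where u: "\<forall>i\<ge>degree p. coeff u i = 0"
    "\<And>r. \<forall>i\<ge>degree p. coeff r i = 0 \<Longrightarrow> poly r w = F u r"
    by blast
  have deg_u: "degree u \<le> n"
    using u(1) p(2) by (intro degree_le) auto
  have "poly v w = F u v" if v: "degree v \<le> n" for v
  proof -
    have v_eq: "v = p * (v div p) + v mod p"
      by simp
    have mod: "v mod p = 0 \<or> degree (v mod p) < degree p"
      using p(1) by (rule degree_mod_less)
    \<comment> \<open>\<open>null_mult\<close> needs a bound on the degrees of the factors; the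
      remainder has lower degree and cannot cancel the leading term of the product.\<close>
    have k: "degree p + degree (v div p) \<le> n"
    proof (cases "v div p = 0")
      case False
      then have "degree (p * (v div p)) = degree p + degree (v div p)"
        using p(1) by (simp add: degree_mult_eq)
      moreover have "degree (p * (v div p)) = degree v"
      proof (cases "v mod p = 0")
        case False
        then have "degree (v mod p) < degree (p * (v div p))"
          using mod calculation by simp
        then show ?thesis
          by (subst (2) v_eq) (simp only: degree_add_eq_left)
      qed (use v_eq in simp)
      ultimately show ?thesis
        using v by simp
    qed (use p in simp)
    have "degree (p * (v div p)) \<le> n"
      using degree_mult_le[of p "v div p"] k by linarith
    then have "F u (p * (v div p)) = 0"
      by (rule null_right[OF deg_u _ null_mult[OF p(3) k]])
    moreover have "poly (v mod p) w = F u (v mod p)"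
      using mod by (intro u(2)) (auto simp: coeff_eq_0)
    moreover have "poly v w = poly (v mod p) w"
      using w by (subst v_eq) (simp only: poly_add poly_mult, simp)
    ultimately show ?thesis
      by (subst (2) v_eq) (simp only: tform_add_right, simp)
  qed
  then show thesis
    using that w1 deg_u by blast
qed

end

section \<open>Rank one matrices below a positive one, and the extreme rays\<close>

lemma toeplitz_psd_iff: "toeplitz_psd n t \<longleftrightarrow> toeplitz_mat (Suc n) t \<in> toeplitz_cone (Suc n)"
  by (auto simp: toeplitz_psd_def toeplitz_cone_iff)

text \<open>All monomials have the same square \<open>t 0\<close> in the form; if it vanishes they
  are all null, and by Cauchy-Schwarz every entry of the matrix is 0.\<close>

lemma (in toeplitz_psd) symbol_0_nonzero:
  assumes "toeplitz_mat (Suc n) t \<noteq> 0\<^sub>m (Suc n) (Suc n)"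
  shows "t 0 \<noteq> 0"
proof
  assume t0: "t 0 = 0"
  have "t (int l - int k) = 0" if "k \<le> n" "l \<le> n" for k l
    using null_right[of "monom 1 k" "monom 1 l"] that t0 by (simp add: tform_monom degree_monom_eq)
  from this[of 0] this[of _ 0] have "t j = 0" if "\<bar>j\<bar> \<le> int n" for j
    using that by (cases j rule: int_cases2) auto
  then show False
    using assms unfolding toeplitz_mat_zero toeplitz_mat_eq_iff by simp
qed

text \<open>Cauchy-Schwarz against the representer \<open>u\<close> bounds |v(w)|^2 by C times F v v
  with C = F u u, so \<open>\<epsilon>\<close> = 1 / C works. The constant polynomial 1 shows C
  \<noteq> 0.\<close>

lemma (in toeplitz_psd) subtract_rank_one:
  assumes "t 0 \<noteq> 0"
  obtains w \<epsilon> where "cmod w = 1" "0 < \<epsilon>" "toeplitz_psd n (\<lambda>j. t j - complex_of_real \<epsilon> * w powi j)"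
proof -
  obtain w u where w: "cmod w = 1" and u: "degree u \<le> n" "\<And>v. degree v \<le> n \<Longrightarrow> poly v w = F u v"
    using evaluation_representer[OF assms] by blast
  define C where "C = Re (F u u)"
  have bound: "(cmod (poly v w))\<^sup>2 \<le> C * Re (F v v)" if "degree v \<le> n" for v
    using cauchy_schwarz[OF u(1) that] u(2)[OF that] by (simp add: C_def)
  have "0 \<le> C"
    using nonneg[OF u(1)] by (simp add: C_def less_eq_complex_def)
  moreover have "C \<noteq> 0"
    using bound[of 1] by auto
  ultimately have "0 < C"
    by simp
  have "0 \<le> tform n (\<lambda>j. t j - complex_of_real (1 / C) * w powi j) p p" if p: "degree p \<le> n" for p
  proof -
    have "tform n (\<lambda>j. t j - complex_of_real (1 / C) * w powi j) p p =
        F p p - complex_of_real (1 / C) * (cnj (poly p w) * poly p w)"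
      using p w by (simp only: tform_diff_symbol tform_scale tform_powi)
    also have "\<dots> = complex_of_real (Re (F p p) - (cmod (poly p w))\<^sup>2 / C)"
      using form_self[OF p] complex_norm_square[of "poly p w"] by (simp add: mult.commute)
    finally have eq: "tform n (\<lambda>j. t j - complex_of_real (1 / C) * w powi j) p p =
        complex_of_real (Re (F p p) - (cmod (poly p w))\<^sup>2 / C)" .
    have "0 \<le> Re (F p p) - (cmod (poly p w))\<^sup>2 / C"
      using bound[OF p] \<open>0 < C\<close> by (simp add: field_simps)
    then show ?thesis
      unfolding eq by (simp add: less_eq_complex_def del: of_real_diff)
  qed
  then show thesis
    using that[of w "1 / C"] w \<open>0 < C\<close> by (simp add: toeplitz_psd_def)
qed

lemma toeplitz_psd_powi:
  assumes "cmod w = 1" "0 \<le> r"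
  shows "toeplitz_psd n (\<lambda>j. complex_of_real r * w powi j)"
proof
  fix p :: "complex poly" assume p: "degree p \<le> n"
  have "tform n (\<lambda>j. complex_of_real r * w powi j) p p = complex_of_real (r * (cmod (poly p w))\<^sup>2)"
    unfolding tform_scale using p assms complex_norm_square[of "poly p w"]
    by (simp add: tform_powi mult.commute)
  then show "0 \<le> tform n (\<lambda>j. complex_of_real r * w powi j) p p"
    using assms by (simp add: less_eq_complex_def del: of_real_mult)
qed

text \<open>Extremality makes the rank one matrix that can be subtracted a multiple c of
  \<open>X\<close>; the diagonal shows c \<noteq> 0, so conversely \<open>X\<close> is a multiple of
  it.\<close>

lemma spans_extreme_ray_imp:
  assumes "spans_extreme_ray (Suc n) X"
  obtains r w where "0 < r" "cmod w = 1" "X = complex_of_real r \<cdot>\<^sub>m toeplitz_mat (Suc n) (\<lambda>j. w powi j)"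
proof -
  have X: "X \<in> toeplitz_cone (Suc n)" "X \<noteq> 0\<^sub>m (Suc n) (Suc n)"
    and extreme: "\<And>Y. Y \<in> toeplitz_cone (Suc n) \<Longrightarrow> X - Y \<in> toeplitz_cone (Suc n) \<Longrightarrow> \<exists>c. Y = c \<cdot>\<^sub>m X"
    using assms by (auto simp: spans_extreme_ray_def)
  obtain t where t: "X = toeplitz_mat (Suc n) t"
    using X(1) by (rule toeplitz_coneE)
  interpret toeplitz_psd n t
    using X(1) by (simp add: toeplitz_psd_iff t)
  have t0: "t 0 \<noteq> 0"
    using symbol_0_nonzero X(2) t by simp
  obtain w \<epsilon> where w: "cmod w = 1" "0 < \<epsilon>" "toeplitz_psd n (\<lambda>j. t j - complex_of_real \<epsilon> * w powi j)"
    using subtract_rank_one[OF t0] by blast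
  then obtain c where c: "toeplitz_mat (Suc n) (\<lambda>j. complex_of_real \<epsilon> * w powi j) = c \<cdot>\<^sub>m X"
    using extreme[of "toeplitz_mat (Suc n) (\<lambda>j. complex_of_real \<epsilon> * w powi j)"] toeplitz_psd_powi[of w \<epsilon> n]
    by (auto simp: toeplitz_psd_iff t toeplitz_mat_diff)
  then have eq: "complex_of_real \<epsilon> * w powi j = c * t j" if "\<bar>j\<bar> \<le> int n" for j
    using that unfolding t toeplitz_mat_smult toeplitz_mat_eq_iff by blast
  have eq0: "complex_of_real \<epsilon> = c * t 0"
    using eq[of 0] by simp
  then have "c \<noteq> 0"
    using w(2) by auto
  have "t j = t 0 * w powi j" if "\<bar>j\<bar> \<le> int n" for j
    using eq[OF that] \<open>c \<noteq> 0\<close> unfolding eq0 by simp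
  moreover have "t 0 = complex_of_real (Re (t 0))" "0 < Re (t 0)"
    using nonneg[of 1] t0 by (auto simp: tform_one less_eq_complex_def complex_eq_iff)
  ultimately have "X = complex_of_real (Re (t 0)) \<cdot>\<^sub>m toeplitz_mat (Suc n) (\<lambda>j. w powi j)"
    unfolding t toeplitz_mat_smult by (intro toeplitz_mat_cong) metis
  then show thesis
    using that w(1) \<open>0 < Re (t 0)\<close> by blast
qed

text \<open>A polynomial vanishing at \<open>z\<close> is null for the rank one matrix, hence for
  every \<open>Y\<close> below it. Applied to x^k (x - z) with polynomial variable x, this gives the
  recursion s (j + 1) = z s j, so the symbol of \<open>Y\<close> is geometric.\<close>

lemma spans_extreme_ray_powi:
  assumes r: "0 < r" and z: "cmod z = 1"
  shows "spans_extreme_ray (Suc n) (complex_of_real r \<cdot>\<^sub>m toeplitz_mat (Suc n) (\<lambda>j. z powi j))"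
  unfolding spans_extreme_ray_def toeplitz_mat_smult
proof (intro conjI allI impI)
  let ?X = "toeplitz_mat (Suc n) (\<lambda>j. complex_of_real r * z powi j)"
  show "?X \<in> toeplitz_cone (Suc n)"
    using toeplitz_psd_powi[of z r n] r z by (simp add: toeplitz_psd_iff)
  show "?X \<noteq> 0\<^sub>m (Suc n) (Suc n)"
    unfolding toeplitz_mat_zero toeplitz_mat_eq_iff using r by (auto intro!: exI[of _ 0])
  fix Y assume Y: "Y \<in> toeplitz_cone (Suc n) \<and> ?X - Y \<in> toeplitz_cone (Suc n)"
  then obtain s where s: "Y = toeplitz_mat (Suc n) s"
    by (auto elim: toeplitz_coneE)
  interpret Y: toeplitz_psd n s
    using Y by (simp add: toeplitz_psd_iff s)
  interpret XY: toeplitz_psd n "\<lambda>j. complex_of_real r * z powi j - s j"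
    using Y by (simp add: toeplitz_psd_iff s toeplitz_mat_diff)
  have null: "tform n s p p = 0" if p: "degree p \<le> n" "poly p z = 0" for p
  proof -
    have "tform n (\<lambda>j. complex_of_real r * z powi j - s j) p p = - tform n s p p"
      unfolding tform_diff_symbol tform_scale using p z by (simp add: tform_powi)
    then show ?thesis
      using XY.nonneg[OF p(1)] Y.nonneg[OF p(1)] by (simp add: less_eq_complex_def complex_eq_iff)
  qed
  have step: "s (int k + 1 - int l) = z * s (int k - int l)" if "k < n" "l \<le> n" for k l
  proof -
    define p where "p = monom 1 (Suc k) - smult z (monom 1 k)"
    have deg: "degree p \<le> n"
      unfolding p_def using that by (intro degree_diff_le) (auto simp: degree_monom_eq smult_monom intro: order_trans[OF degree_monom_le])
    have "poly p z = 0"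
      by (simp add: p_def poly_monom)
    then have "tform n s (monom 1 l) p = 0"
      using Y.null_right[OF _ deg null[OF deg]] that(2) by (simp add: degree_monom_eq)
    then show ?thesis
      using that by (simp add: p_def tform_simps tform_monom algebra_simps)
  qed
  have pos: "s (int k) = z ^ k * s 0" if "k \<le> n" for k
    using that
  proof (induction k)
    case (Suc k)
    then show ?case
      using step[of k 0] by (simp add: add.commute)
  qed simp
  have neg: "z ^ k * s (- int k) = s 0" if "k \<le> n" for k
    using that
  proof (induction k)
    case (Suc k)
    then have "s (- int k) = z * s (- int (Suc k))"
      using step[of 0 "Suc k"] by simp
    then show ?case
      using Suc by (simp add: mult_ac)
  qed simp
  have "z \<noteq> 0"
    using z by auto
  have s_eq: "s j = z powi j * s 0" if "\<bar>j\<bar> \<le> int n" for j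
  proof (cases j rule: int_cases2)
    case (nonneg k)
    then show ?thesis
      using pos[of k] that by simp
  next
    case (nonpos k)
    then show ?thesis
      using neg[of k] that \<open>z \<noteq> 0\<close> by (simp add: power_int_minus field_simps)
  qed
  have "s j = s 0 / complex_of_real r * (complex_of_real r * z powi j)" if "\<bar>j\<bar> \<le> int n" for j
    by (subst s_eq[OF that]) (use r in simp)
  then have "Y = toeplitz_mat (Suc n) (\<lambda>j. s 0 / complex_of_real r * (complex_of_real r * z powi j))"
    unfolding s by (rule toeplitz_mat_cong)
  then show "\<exists>c. Y = toeplitz_mat (Suc n) (\<lambda>j. c * (complex_of_real r * z powi j))" ..
qed

lemma extreme_rays_eq:
  "{T. spans_extreme_ray (Suc n) T} =
    {complex_of_real r \<cdot>\<^sub>m toeplitz_mat (Suc n) (\<lambda>k. z powi k) | r z. 0 < r \<and> cmod z = 1}"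
  using spans_extreme_ray_imp spans_extreme_ray_powi by (auto, metis)

lemma gamma_toeplitz_eq:
  assumes "cmod z = 1"
  shows "gamma_toeplitz n z = complex_of_real (1 / real n) \<cdot>\<^sub>m toeplitz_mat n (\<lambda>k. z powi k)"
proof (rule eq_matI)
  fix k l assume "k < dim_row (complex_of_real (1 / real n) \<cdot>\<^sub>m toeplitz_mat n (\<lambda>k. z powi k))"
    and "l < dim_col (complex_of_real (1 / real n) \<cdot>\<^sub>m toeplitz_mat n (\<lambda>k. z powi k))"
  then have kl: "k < n" "l < n"
    by simp_all
  have z: "z \<noteq> 0" "cnj z = inverse z"
    using assms by (auto simp: cnj_eq_inverse_circle field_simps)
  have "complex_of_real (sqrt (real n)) * complex_of_real (sqrt (real n)) = of_nat n"
    by (simp flip: of_real_mult)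
  then show "gamma_toeplitz n z $$ (k, l) =
      (complex_of_real (1 / real n) \<cdot>\<^sub>m toeplitz_mat n (\<lambda>k. z powi k)) $$ (k, l)"
    using kl z by (simp add: gamma_toeplitz_def ketbra_def fvec_def toeplitz_mat_def power_int_diff
        divide_inverse power_inverse mult_ac flip: inverse_mult_distrib)
qed (simp_all add: gamma_toeplitz_def ketbra_def fvec_def)

lemma gamma_rays_eq:
  "{complex_of_real r \<cdot>\<^sub>m gamma_toeplitz (Suc n) z | r z. 0 < r \<and> cmod z = 1} =
    {complex_of_real r \<cdot>\<^sub>m toeplitz_mat (Suc n) (\<lambda>k. z powi k) | r z. 0 < r \<and> cmod z = 1}"
proof (intro equalityI subsetI)
  fix T assume "T \<in> {complex_of_real r \<cdot>\<^sub>m gamma_toeplitz (Suc n) z | r z. 0 < r \<and> cmod z = 1}"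
  then obtain r z where "T = complex_of_real r \<cdot>\<^sub>m gamma_toeplitz (Suc n) z" "0 < r" "cmod z = 1"
    by blast
  then show "T \<in> {complex_of_real r \<cdot>\<^sub>m toeplitz_mat (Suc n) (\<lambda>k. z powi k) | r z. 0 < r \<and> cmod z = 1}"
    by (intro CollectI exI[of _ "r / real (Suc n)"] exI[of _ z])
       (simp add: gamma_toeplitz_eq toeplitz_mat_smult)
next
  fix T assume "T \<in> {complex_of_real r \<cdot>\<^sub>m toeplitz_mat (Suc n) (\<lambda>k. z powi k) | r z. 0 < r \<and> cmod z = 1}"
  then obtain r z where "T = complex_of_real r \<cdot>\<^sub>m toeplitz_mat (Suc n) (\<lambda>k. z powi k)" "0 < r" "cmod z = 1"
    by blast
  then show "T \<in> {complex_of_real r \<cdot>\<^sub>m gamma_toeplitz (Suc n) z | r z. 0 < r \<and> cmod z = 1}"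
    by (intro CollectI exI[of _ "r * real (Suc n)"] exI[of _ z])
       (simp add: gamma_toeplitz_eq toeplitz_mat_smult mult.assoc[symmetric] del: of_nat_Suc)
qed

section \<open>Pure states\<close>

text \<open>Parseval: the middle coefficient is the mean of |p|^2 over the circle. Normalizing a
  state means making it 1.\<close>

lemma coeff_star_mult_self:
  assumes "degree p \<le> n"
  shows "coeff (star n p * p) n = complex_of_real (\<Sum>i\<le>n. (cmod (coeff p i))\<^sup>2)"
proof -
  have rev: "(\<Sum>k<Suc n. g k) = (\<Sum>k<Suc n. g (n - k))" for g :: "nat \<Rightarrow> complex"
    using sum.nat_diff_reindex[of g "Suc n"] by simp
  have "coeff (star n p * p) n = (\<Sum>i\<le>n. cnj (coeff p (n - i)) * coeff p (n - i))"
    unfolding coeff_mult by (intro sum.cong refl) (simp add: coeff_star)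
  also have "\<dots> = (\<Sum>i\<le>n. cnj (coeff p i) * coeff p i)"
    using rev[of "\<lambda>i. cnj (coeff p i) * coeff p i"] by (simp only: lessThan_Suc_atMost)
  finally show ?thesis
    by (simp add: complex_norm_square mult.commute del: of_real_power)
qed

lemma coeff_star_mult_self_pos:
  assumes "degree p \<le> n" "p \<noteq> 0"
  obtains r where "0 < r" "coeff (star n p * p) n = complex_of_real r"
proof
  have "0 < (cmod (coeff p (degree p)))\<^sup>2"
    using assms by simp
  then show "0 < (\<Sum>i\<le>n. (cmod (coeff p i))\<^sup>2)"
    using assms(1) by (intro sum_pos2[of _ "degree p"]) auto
qed (rule coeff_star_mult_self[OF assms(1)])

lemma trig_nonneg_coeff_pos:
  assumes "trig_nonneg n R" "R \<noteq> 0"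
  obtains r where "0 < r" "coeff R n = complex_of_real r"
proof -
  obtain p where p: "degree p \<le> n" "R = star n p * p"
    using assms(1) by (rule fejer_riesz)
  then have "p \<noteq> 0"
    using assms(2) by auto
  then show thesis
    using coeff_star_mult_self_pos[OF p(1)] that p(2) by metis
qed

lemma trig_nonneg_root_le:
  assumes "trig_nonneg n S" "trig_nonneg n (R - S)" "cmod w = 1" "poly R w = 0"
  shows "poly S w = 0"
proof -
  have "0 \<le> poly S w * cnj w ^ n" "0 \<le> poly (R - S) w * cnj w ^ n"
    using assms unfolding trig_nonneg_def by blast+
  then have "poly S w * cnj w ^ n = 0"
    using assms(4) by (simp add: less_eq_complex_def complex_eq_iff)
  then show ?thesis
    using assms(3) by auto
qed

text \<open>All \<open>2 n\<close> zeroes of \<open>R = star n p * p\<close> lie on the circle, and a smaller nonnegative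
  trigonometric polynomial must share them, so it is a multiple of \<open>R\<close>.\<close>

lemma trig_nonneg_le_imp_multiple:
  assumes "degree p = n" "\<And>w. poly p w = 0 \<Longrightarrow> cmod w = 1"
    and "trig_nonneg n S" "trig_nonneg n (star n p * p - S)"
  obtains c where "S = smult c (star n p * p)"
  using assms
proof (induction n arbitrary: p S thesis)
  case 0
  obtain a where a: "p = [:a:]"
    using 0(2) by (rule degree_eq_zeroE)
  \<comment> \<open>The zero constant would vanish at 0, which is not on the circle.\<close>
  have "a \<noteq> 0"
    using 0(3)[of 0] a by auto
  obtain b where b: "S = [:b:]"
    using 0(4) by (auto simp: trig_nonneg_def elim: degree_eq_zeroE)
  have "star 0 p = [:cnj a:]"
    by (rule poly_eqI) (simp add: a coeff_star coeff_pCons split: nat.splits)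
  with \<open>a \<noteq> 0\<close> show ?case
    by (intro 0(1)[of "b / (cnj a * a)"]) (simp add: a b)
next
  case (Suc n)
  have "\<not> constant (poly p)"
    using Suc.prems(2) by (simp add: constant_degree)
  then obtain w where w: "poly p w = 0"
    using fundamental_theorem_of_algebra by blast
  have w1: "cmod w = 1" "w \<noteq> 0"
    using Suc.prems(3)[OF w] by auto
  obtain q where q: "p = [:- w, 1:] * q"
    using w unfolding poly_eq_0_iff_dvd by (auto elim: dvdE)
  have "q \<noteq> 0"
    using Suc.prems(2) q by auto
  then have "degree p = degree [:- w, 1:] + degree q"
    unfolding q by (intro degree_mult_eq) auto
  then have deg_q: "degree q = n"
    using Suc.prems(2) by simp
  have "star (1 + n) p = star 1 [:- w, 1:] * star n q"
    unfolding q by (rule star_mult) (use deg_q in auto)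
  then have R: "star (Suc n) p * p = star 1 [:- w, 1:] * [:- w, 1:] * (star n q * q)"
    unfolding q by (simp only: plus_1_eq_Suc mult_ac)
  have "poly (star (Suc n) p * p) w = 0"
    using w by simp
  then have "poly S w = 0"
    using trig_nonneg_root_le Suc.prems(4,5) w1 by blast
  then obtain S' where S': "S = star 1 [:- w, 1:] * [:- w, 1:] * S'" "trig_nonneg n S'"
    using trig_nonneg_factor[OF Suc.prems(4)] w1 by metis
  have "star (Suc n) p * p - S = star 1 [:- w, 1:] * [:- w, 1:] * (star n q * q - S')"
    unfolding R S' right_diff_distrib ..
  moreover have "degree (star n q * q - S') \<le> 2 * n"
    using S' degree_star_mult_self[of q n] deg_q by (simp add: trig_nonneg_def degree_diff_le)
  ultimately have "trig_nonneg n (star n q * q - S')"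
    using trig_nonneg_cancel Suc.prems(5) by metis
  moreover have "cmod v = 1" if "poly q v = 0" for v
    using that by (intro Suc.prems(3)) (simp add: q)
  ultimately obtain c where "S' = smult c (star n q * q)"
    using Suc.IH[OF _ deg_q _ S'(2)] by blast
  then show ?case
    by (intro Suc.prems(1)[of c]) (simp only: R S' mult_smult_right)
qed

lemma state_functional:
  assumes "\<phi> \<in> state_space (Suc n)"
  obtains R where "trig_nonneg n R" "coeff R n = 1" "\<phi> = functional n R"
proof -
  have "\<phi> \<in> dual (Suc n)"
    using assms by (simp add: state_space_def)
  then obtain R where R: "degree R \<le> 2 * n" "\<phi> = functional n R"
    by (rule dual_functional)
  then show thesis
    using assms functional_state_iff[OF R(1)] that by blast
qed

text \<open>In a convex decomposition R = s R1 + (1 - s) R2 the part s R1 lies below R, hence is a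
  multiple of it, and the middle coefficients, all equal to 1 before scaling, fix the
  multiple.\<close>

lemma pure_state_if_roots_on_circle:
  assumes p: "degree p = n" "\<And>w. poly p w = 0 \<Longrightarrow> cmod w = 1"
    and norm: "coeff (star n p * p) n = 1"
  shows "functional n (star n p * p) \<in> pure_states (Suc n)"
proof -
  define R where "R = star n p * p"
  have R: "trig_nonneg n R" "coeff R n = 1"
    using trig_nonneg_star_mult_self[of p n] p norm by (auto simp: R_def)
  have state: "functional n R \<in> state_space (Suc n)"
    using R by (subst functional_state_iff) (auto simp: trig_nonneg_def)
  have eq: "R1 = R" if R1: "trig_nonneg n R1" "coeff R1 n = 1" and R2: "trig_nonneg n R2"
    and s: "0 < s" "s < 1" and sum: "R = smult (complex_of_real s) R1 + smult (complex_of_real (1 - s)) R2"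
    for R1 R2 s
  proof -
    have "trig_nonneg n (smult (complex_of_real s) R1)"
      using R1 s by (intro trig_nonneg_smult) auto
    moreover have "R - smult (complex_of_real s) R1 = smult (complex_of_real (1 - s)) R2"
      using sum by simp
    then have "trig_nonneg n (R - smult (complex_of_real s) R1)"
      using R2 s trig_nonneg_smult[of n R2 "1 - s"] by simp
    ultimately obtain c where c: "smult (complex_of_real s) R1 = smult c R"
      using trig_nonneg_le_imp_multiple[OF p] unfolding R_def by blast
    have "complex_of_real s = c"
      using arg_cong[OF c, of "\<lambda>q. coeff q n"] R1 R by simp
    then show ?thesis
      using arg_cong[OF c, of "smult (1 / complex_of_real s)"] s by auto
  qed
  show ?thesis
    unfolding R_def[symmetric] pure_states_def
  proof (intro CollectI conjI ballI allI impI state)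
    fix \<psi> \<theta> and s :: real
    assume \<psi>: "\<psi> \<in> state_space (Suc n)" and \<theta>: "\<theta> \<in> state_space (Suc n)"
      and conv: "0 < s \<and> s < 1 \<and> (\<forall>T\<in>toeplitz_sys (Suc n).
        functional n R T = complex_of_real s * \<psi> T + complex_of_real (1 - s) * \<theta> T)"
    obtain R1 where R1: "trig_nonneg n R1" "coeff R1 n = 1" "\<psi> = functional n R1"
      using \<psi> by (rule state_functional)
    obtain R2 where R2: "trig_nonneg n R2" "coeff R2 n = 1" "\<theta> = functional n R2"
      using \<theta> by (rule state_functional)
    let ?Q = "smult (complex_of_real s) R1 + smult (complex_of_real (1 - s)) R2"
    have "functional n R = functional n ?Q"
    proof (rule functional_eqI)
      show "functional n R \<in> extensional (toeplitz_sys (Suc n))"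
        by (simp add: functional_def)
      show "functional n R (toeplitz_mat (Suc n) t) = tsum n t ?Q" for t
        using conv by (simp only: R1(3) R2(3) functional_toeplitz_mat tsum_add tsum_smult
            toeplitz_mat_in_sys simp_thms ball_simps)
           (metis R1(3) R2(3) functional_toeplitz_mat toeplitz_mat_in_sys)
    qed
    moreover have "degree ?Q \<le> 2 * n"
      using R1 R2 by (intro degree_add_le) (auto simp: trig_nonneg_def)
    ultimately have sum: "R = ?Q"
      using R by (intro functional_inject[of R n ?Q]) (auto simp: trig_nonneg_def)
    then have "R = smult (complex_of_real (1 - s)) R2 + smult (complex_of_real (1 - (1 - s))) R1"
      by (simp add: add.commute)
    then have "R1 = R" "R2 = R"
      using eq[OF R1(1,2) R2(1) _ _ sum] eq[OF R2(1,2) R1(1), of "1 - s"] conv by auto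
    then show "\<psi> = functional n R" "\<theta> = functional n R"
      using R1 R2 by auto
  qed
qed

text \<open>The witness \<open>\<epsilon> (1 + z\<^sup>2)\<close> encodes the trigonometric polynomial \<open>2 \<epsilon> Re z\<close>.\<close>

lemma not_pure_if_positive_factor:
  assumes a: "degree a \<le> 1" and \<epsilon>: "0 < \<epsilon>" "\<And>z. cmod z = 1 \<Longrightarrow> 2 * \<epsilon> \<le> (cmod (poly a z))\<^sup>2"
    and q: "degree q \<le> m" and R: "R = star 1 a * a * (star m q * q)" and norm: "coeff R (Suc m) = 1"
  shows "functional (Suc m) R \<notin> pure_states (Suc (Suc m))"
proof
  assume pure: "functional (Suc m) R \<in> pure_states (Suc (Suc m))"
  define B where "B = star 1 a * a"
  define M where "M = star m q * q"
  \<comment> \<open>The perturbation is at most 2 |s| \<epsilon> on the circle, which the lower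
    bound for |a|^2 absorbs when |s| \<le> 1. Its zero at i serves as a test point, where
    \<open>B\<close> does not vanish.\<close>
  define g where "g s = smult (complex_of_real (s * \<epsilon>)) [:1, 0, 1:]" for s
  define Q where "Q s = (B + g s) * M" for s
  have R': "R = B * M"
    by (simp only: R B_def M_def)
  have deg_B: "degree B \<le> 2" and deg_M: "degree M \<le> 2 * m"
    using degree_star_mult_self[OF a] degree_star_mult_self[OF q] by (auto simp: B_def M_def)
  have M: "trig_nonneg m M" "M \<noteq> 0"
    using trig_nonneg_star_mult_self[OF q] norm by (auto simp: M_def R')
  have B_i: "poly B \<i> \<noteq> 0"
  proof
    assume "poly B \<i> = 0"
    then have "complex_of_real ((cmod (poly a \<i>))\<^sup>2) = 0"
      using poly_star_mult_self[OF a, of \<i>] by (simp only: B_def norm_ii mult_zero_left)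
    then show False
      using \<epsilon>(2)[of \<i>] \<epsilon>(1) by simp
  qed
  have g_i: "poly (g s) \<i> = 0" for s
    by (simp add: g_def)
  have Q_nonneg: "trig_nonneg (Suc m) (Q s)" if s: "\<bar>s\<bar> \<le> 1" for s
    unfolding trig_nonneg_def
  proof (intro conjI allI impI)
    have "degree (g s) \<le> 2"
      by (simp add: g_def)
    then have "degree (B + g s) \<le> 2"
      by (rule degree_add_le[OF deg_B])
    moreover have "degree (Q s) \<le> degree (B + g s) + degree M"
      unfolding Q_def by (rule degree_mult_le)
    ultimately show "degree (Q s) \<le> 2 * Suc m"
      using deg_M by simp
    fix z :: complex assume z: "cmod z = 1"
    have "poly (g s) z * cnj z = complex_of_real (s * \<epsilon>) * (cnj z + z * (z * cnj z))"
      by (simp add: g_def algebra_simps)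
    also have "\<dots> = complex_of_real (s * \<epsilon> * (2 * Re z))"
      by (simp only: mult_cnj_circle[OF z] mult_1_right) (simp add: complex_eq_iff)
    finally have "poly (B + g s) z * cnj z = complex_of_real ((cmod (poly a z))\<^sup>2 + s * \<epsilon> * (2 * Re z))"
      using poly_star_mult_self[OF a z] by (simp add: B_def distrib_right)
    moreover have "0 \<le> (cmod (poly a z))\<^sup>2 + s * \<epsilon> * (2 * Re z)"
    proof -
      have "\<bar>s * Re z\<bar> \<le> 1"
        using s abs_Re_le_cmod[of z] z unfolding abs_mult by (simp add: mult_le_one)
      then have "2 * \<epsilon> * (- 1) \<le> 2 * \<epsilon> * (s * Re z)"
        using \<epsilon>(1) by (intro mult_left_mono) auto
      then show ?thesis
        using \<epsilon>(2)[OF z] by (simp add: mult_ac)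
    qed
    ultimately have "0 \<le> poly (B + g s) z * cnj z"
      by (simp add: less_eq_complex_def del: of_real_add of_real_mult of_real_power)
    moreover have "0 \<le> poly M z * cnj z ^ m"
      using M z by (simp add: trig_nonneg_def)
    ultimately have "0 \<le> (poly (B + g s) z * cnj z) * (poly M z * cnj z ^ m)"
      by (rule mult_nonneg_nonneg)
    then show "0 \<le> poly (Q s) z * cnj z ^ Suc m"
      by (simp add: Q_def mult_ac)
  qed
  have Q_nz: "Q s \<noteq> 0" for s
  proof -
    have "poly (B + g s) \<i> \<noteq> 0"
      using B_i g_i by simp
    then have "B + g s \<noteq> 0"
      by (metis poly_0)
    then show ?thesis
      using M(2) by (simp add: Q_def)
  qed
  \<comment> \<open>\<open>Q 1\<close> and \<open>Q (-1)\<close> may have different middle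
    coefficients; they are normalized separately, and the convex weights become r1 / 2 and r2 /
    2.\<close>
  obtain r1 where r1: "0 < r1" "coeff (Q 1) (Suc m) = complex_of_real r1"
    using trig_nonneg_coeff_pos[OF Q_nonneg Q_nz] by (metis abs_one order_refl)
  obtain r2 where r2: "0 < r2" "coeff (Q (-1)) (Suc m) = complex_of_real r2"
    using trig_nonneg_coeff_pos[OF Q_nonneg Q_nz] by (metis abs_minus_cancel abs_one order_refl)
  have sum: "Q 1 + Q (-1) = smult 2 R"
  proof -
    have "g (-1) = - g 1"
      by (simp add: g_def)
    then have "Q 1 + Q (-1) = R + R"
      by (simp add: Q_def R' algebra_simps)
    also have "\<dots> = smult 2 R"
      by (rule poly_eqI) (simp only: coeff_add coeff_smult mult_2)
    finally show ?thesis .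
  qed
  then have "complex_of_real r1 + complex_of_real r2 = 2"
    using r1 r2 norm by (metis coeff_add coeff_smult mult_1_right)
  then have "r1 + r2 = 2"
    by (metis of_real_add of_real_eq_iff of_real_numeral)
  have state: "functional (Suc m) (smult (complex_of_real (1 / r)) (Q s)) \<in> state_space (Suc (Suc m))"
    if "\<bar>s\<bar> \<le> 1" "0 < r" "coeff (Q s) (Suc m) = complex_of_real r" for r s
    using Q_nonneg[OF that(1)] that trig_nonneg_smult[OF Q_nonneg[OF that(1)], of "1 / r"]
    by (subst functional_state_iff) (auto simp: trig_nonneg_def)
  let ?\<psi> = "functional (Suc m) (smult (complex_of_real (1 / r1)) (Q 1))"
  let ?\<theta> = "functional (Suc m) (smult (complex_of_real (1 / r2)) (Q (-1)))"
  have states: "?\<psi> \<in> state_space (Suc (Suc m))" "?\<theta> \<in> state_space (Suc (Suc m))"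
    using state r1 r2 by simp_all
  have "functional (Suc m) R T = complex_of_real (r1 / 2) * ?\<psi> T + complex_of_real (1 - r1 / 2) * ?\<theta> T"
    if "T \<in> toeplitz_sys (Suc (Suc m))" for T
  proof -
    have "R = smult (1 / 2) (Q 1) + smult (1 / 2) (Q (-1))"
      using sum by (simp flip: smult_add_right)
    moreover have r1r2: "1 - r1 / 2 = r2 / 2"
      using \<open>r1 + r2 = 2\<close> by simp
    ultimately show ?thesis
      unfolding r1r2 using that r1(1) r2(1) by (simp add: functional_def tsum_add tsum_smult)
  qed
  moreover have "0 < r1 / 2" "r1 / 2 < 1"
    using r1 r2 \<open>r1 + r2 = 2\<close> by auto
  ultimately have "?\<psi> = functional (Suc m) R"
    using pure states unfolding pure_states_def mem_Collect_eq by blast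
  then have "smult (complex_of_real (1 / r1)) (Q 1) = R"
    using Q_nonneg[of 1] degree_mult_le[of B M] deg_B deg_M
    by (intro functional_inject[of _ "Suc m"]) (auto simp: trig_nonneg_def R')
  then have "smult (complex_of_real r1) R = Q 1"
    using r1 by auto
  then have "smult (complex_of_real r1) B * M = (B + g 1) * M"
    by (simp add: R' Q_def)
  then have eq: "smult (complex_of_real r1) B = B + g 1"
    using M(2) by (simp only: mult_cancel_right simp_thms)
  \<comment> \<open>At i the perturbation vanishes and \<open>B\<close> does not, so the scalar is
    1; but then \<open>g 1\<close> would be 0.\<close>
  have "complex_of_real r1 = 1"
    using arg_cong[OF eq, of "\<lambda>q. poly q \<i>"] B_i g_i by simp
  then have "g 1 = 0"
    using eq by simp
  then show False
    using \<epsilon>(1) by (simp add: g_def)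
qed

text \<open>A zero w off the circle gives the positive factor |z - w|^2, at least (1 - |w|)^2 on the
  circle. If the degree drops, the zero at infinity gives the constant factor 1. Half of these
  bounds is the \<open>\<epsilon>\<close> of the perturbation.\<close>

lemma pure_state_imp_roots_on_circle:
  assumes pure: "functional n (star n p * p) \<in> pure_states (Suc n)" and p: "degree p \<le> n"
    and norm: "coeff (star n p * p) n = 1"
  shows "degree p = n \<and> (\<forall>w. poly p w = 0 \<longrightarrow> cmod w = 1)"
proof (intro conjI allI impI)
  show "degree p = n"
  proof (rule ccontr)
    assume "degree p \<noteq> n"
    then obtain m where m: "n = Suc m" "degree p \<le> m"
      using p by (cases n) auto
    have "star 1 1 * 1 = [:0, 1:]"
      by (rule poly_eqI) (auto simp: coeff_star coeff_pCons split: nat.splits)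
    then have "star n p * p = star 1 1 * 1 * (star m p * p)"
      using m by (simp add: star_Suc)
    then show False
      using not_pure_if_positive_factor[of 1 "1 / 2" p m "star n p * p"] m pure norm by simp
  qed
  fix w assume w: "poly p w = 0"
  show "cmod w = 1"
  proof (rule ccontr)
    assume w1: "cmod w \<noteq> 1"
    have "p \<noteq> 0"
      using norm by auto
    obtain q where q: "p = [:- w, 1:] * q"
      using w unfolding poly_eq_0_iff_dvd by (auto elim: dvdE)
    with \<open>p \<noteq> 0\<close> have "q \<noteq> 0"
      by auto
    then have "degree p = degree [:- w, 1:] + degree q"
      unfolding q by (intro degree_mult_eq) auto
    then obtain m where m: "n = Suc m" "degree q \<le> m"
      using p by (cases n) auto
    have "star (1 + m) p = star 1 [:- w, 1:] * star m q"
      unfolding q by (rule star_mult) (use m in auto)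
    then have R: "star n p * p = star 1 [:- w, 1:] * [:- w, 1:] * (star m q * q)"
      unfolding q m by (simp only: plus_1_eq_Suc mult_ac)
    have "2 * ((1 - cmod w)\<^sup>2 / 2) \<le> (cmod (poly [:- w, 1:] z))\<^sup>2" if "cmod z = 1" for z
      using power_mono[OF norm_triangle_ineq3[of z w] abs_ge_zero, of 2] that by simp
    then show False
      using not_pure_if_positive_factor[of "[:- w, 1:]" "(1 - cmod w)\<^sup>2 / 2" q m "star n p * p"]
        m w1 pure norm R by simp
  qed
qed

text \<open>For n = 0 the zero polynomial, whose \<open>proots\<close> is empty, would satisfy the
  left side but not the right.\<close>

lemma all_zeroes_on_circle_iff:
  fixes p :: "complex poly"
  assumes "n \<ge> 1"
  shows "all_zeroes_on_circle n p \<longleftrightarrow> degree p = n \<and> (\<forall>w. poly p w = 0 \<longrightarrow> cmod w = 1)"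
proof (cases "p = 0")
  case False
  then show ?thesis
    by (auto simp: all_zeroes_on_circle_def size_proots_complex)
qed (use assms in \<open>simp add: all_zeroes_on_circle_def\<close>)

lemma pure_statesE:
  assumes "\<phi> \<in> pure_states (Suc n)"
  obtains p where "degree p = n" "\<And>w. poly p w = 0 \<Longrightarrow> cmod w = 1"
    "coeff (star n p * p) n = 1" "\<phi> = functional n (star n p * p)"
proof -
  have "\<phi> \<in> state_space (Suc n)"
    using assms by (simp add: pure_states_def)
  then obtain R where R: "trig_nonneg n R" "coeff R n = 1" "\<phi> = functional n R"
    by (rule state_functional)
  obtain p where p: "degree p \<le> n" "R = star n p * p"
    using R(1) by (rule fejer_riesz)
  then show thesis
    using pure_state_imp_roots_on_circle[of n p] assms R that by auto
qed

lemma pure_states_eq: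
  assumes "n \<ge> 1"
  shows "pure_states (Suc n) = {vector_functional (Suc n) \<xi> | \<xi>.
    \<xi> \<in> carrier_vec (Suc n) \<and> hinner \<xi> \<xi> = 1 \<and> all_zeroes_on_circle n (vec_poly n \<xi>)}"
proof (intro equalityI subsetI)
  fix \<phi> assume "\<phi> \<in> pure_states (Suc n)"
  then obtain p where p: "degree p = n" "\<And>w. poly p w = 0 \<Longrightarrow> cmod w = 1"
    "coeff (star n p * p) n = 1" "\<phi> = functional n (star n p * p)"
    by (rule pure_statesE) blast
  obtain \<xi> where \<xi>: "\<xi> \<in> carrier_vec (Suc n)" "vec_poly n \<xi> = p"
    using vec_poly_surj[of p n] p(1) by blast
  then show "\<phi> \<in> {vector_functional (Suc n) \<xi> | \<xi>.
    \<xi> \<in> carrier_vec (Suc n) \<and> hinner \<xi> \<xi> = 1 \<and> all_zeroes_on_circle n (vec_poly n \<xi>)}"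
    using p assms by (auto intro!: exI[of _ \<xi>] simp: vector_functional_eq hinner_self_eq all_zeroes_on_circle_iff)
next
  fix \<phi> assume "\<phi> \<in> {vector_functional (Suc n) \<xi> | \<xi>.
    \<xi> \<in> carrier_vec (Suc n) \<and> hinner \<xi> \<xi> = 1 \<and> all_zeroes_on_circle n (vec_poly n \<xi>)}"
  then show "\<phi> \<in> pure_states (Suc n)"
    using assms by (auto simp: vector_functional_eq hinner_self_eq all_zeroes_on_circle_iff
        intro!: pure_state_if_roots_on_circle)
qed

section \<open>The space of pure states\<close>

definition root_poly :: "nat \<Rightarrow> (nat \<Rightarrow> complex) \<Rightarrow> complex poly" where
  "root_poly n x = (\<Prod>i<n. [:- x i, 1:])"

lemma root_poly_0 [simp]: "root_poly 0 x = 1"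
  by (simp add: root_poly_def)

lemma root_poly_Suc: "root_poly (Suc n) x = [:- x n, 1:] * root_poly n x"
  by (simp add: root_poly_def mult.commute del: mult_pCons_left mult_pCons_right)

lemma root_poly_nonzero: "root_poly n x \<noteq> 0"
  by (simp add: root_poly_def)

lemma degree_root_poly: "degree (root_poly n x) = n"
  by (simp add: root_poly_def degree_prod_eq_sum_degree)

lemma poly_root_poly_eq_0_iff: "poly (root_poly n x) w = 0 \<longleftrightarrow> (\<exists>i<n. w = x i)"
  by (auto simp: root_poly_def poly_prod)

lemma root_poly_cong: "(\<And>i. i < n \<Longrightarrow> x i = y i) \<Longrightarrow> root_poly n x = root_poly n y"
  by (simp add: root_poly_def)

lemma proots_root_poly: "proots (root_poly n x) = image_mset x (mset_set {..<n})"
proof -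
  have "proots (root_poly n x) = (\<Sum>i<n. {#x i#})"
    unfolding root_poly_def by (subst proots_prod) auto
  then show ?thesis
    by (simp add: sum_unfold_sum_mset)
qed

lemma complex_poly_eq_root_poly:
  fixes p :: "complex poly"
  assumes "degree p = n"
  obtains x c where "p = smult c (root_poly n x)"
  using assms
proof (induction n arbitrary: p thesis)
  case 0
  then obtain c where "p = [:c:]"
    by (auto elim: degree_eq_zeroE)
  then show ?case
    by (intro 0(1)[of c undefined]) simp
next
  case (Suc n)
  have "\<not> constant (poly p)"
    using Suc.prems(2) by (simp add: constant_degree)
  then obtain w where "poly p w = 0"
    using fundamental_theorem_of_algebra by blast
  then obtain q where q: "p = [:- w, 1:] * q"
    unfolding poly_eq_0_iff_dvd by (auto elim: dvdE)
  have "q \<noteq> 0"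
    using Suc.prems(2) q by auto
  then have "degree p = degree [:- w, 1:] + degree q"
    unfolding q by (intro degree_mult_eq) auto
  then have "degree q = n"
    using Suc.prems(2) by simp
  then obtain x c where "q = smult c (root_poly n x)"
    using Suc.IH by blast
  moreover have "root_poly n (x(n := w)) = root_poly n x"
    by (rule root_poly_cong) simp
  ultimately show ?case
    by (intro Suc.prems(1)[of c "x(n := w)"]) (simp add: q root_poly_Suc del: fun_upd_apply, simp)
qed

text \<open>Factor by factor, 1 - cnj w z = - cnj w (z - w) when |w| = 1. Hence for zeroes on the
  circle \<open>star n p * p\<close> is a nonzero multiple of the square of the monic p.\<close>

lemma star_root_poly:
  assumes "\<And>i. i < n \<Longrightarrow> cmod (x i) = 1"
  obtains c where "c \<noteq> 0" "star n (root_poly n x) = smult c (root_poly n x)"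
  using assms
proof (induction n arbitrary: thesis)
  case 0
  have "star 0 1 = 1"
    by (rule poly_eqI) (simp add: coeff_star)
  then show ?case
    by (intro 0(1)[of 1]) simp_all
next
  case (Suc n)
  obtain c where c: "c \<noteq> 0" "star n (root_poly n x) = smult c (root_poly n x)"
    using Suc.IH Suc.prems(2) by (metis less_Suc_eq)
  have xn: "cmod (x n) = 1"
    using Suc.prems(2) by simp
  then have "star 1 [:- x n, 1:] = smult (- cnj (x n)) [:- x n, 1:]"
    unfolding star_linear using mult_cnj_circle[OF xn] by (simp add: mult.commute)
  moreover have "star (1 + n) (root_poly (Suc n) x) = star 1 [:- x n, 1:] * star n (root_poly n x)"
    unfolding root_poly_Suc by (rule star_mult) (simp_all add: degree_root_poly)
  ultimately have "star (1 + n) (root_poly (Suc n) x) = smult (c * - cnj (x n)) (root_poly (Suc n) x)"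
    unfolding root_poly_Suc c(2) by (simp only: mult_smult_left mult_smult_right smult_smult)
  moreover have "c * - cnj (x n) \<noteq> 0"
    using c xn by auto
  ultimately show ?case
    using Suc.prems(1) by (simp only: plus_1_eq_Suc)
qed

definition root_form :: "nat \<Rightarrow> (nat \<Rightarrow> complex) \<Rightarrow> complex poly" where
  "root_form n x = star n (root_poly n x) * root_poly n x"

lemma coeff_root_form_pos:
  obtains r where "0 < r" "coeff (root_form n x) n = complex_of_real r"
  by (rule coeff_star_mult_self_pos[of "root_poly n x" n])
     (auto simp: degree_root_poly root_poly_nonzero root_form_def intro: that)

lemma coeff_root_form_nonzero: "coeff (root_form n x) n \<noteq> 0"
  by (rule coeff_root_form_pos[of n x]) simp

lemma degree_root_form: "degree (root_form n x) \<le> 2 * n"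
  unfolding root_form_def by (rule degree_star_mult_self) (simp add: degree_root_poly)

text \<open>\<open>root_poly\<close> is monic, so its coefficients are polynomials in the zeroes;
  dividing by the positive middle coefficient normalizes without choosing a unit vector. Both serve
  continuity.\<close>

definition root_state :: "nat \<Rightarrow> (nat \<Rightarrow> complex) \<Rightarrow> complex Matrix.mat \<Rightarrow> complex" where
  "root_state n x = functional n (smult (1 / coeff (root_form n x) n) (root_form n x))"

text \<open>The phase of \<open>c\<close> is lost in \<open>cnj c * c\<close> and its modulus is
  fixed by the normalization, so the state depends only on the zeroes.\<close>

lemma root_state_eq:
  assumes "p = smult c (root_poly n x)" "coeff (star n p * p) n = 1"
  shows "functional n (star n p * p) = root_state n x"
proof -
  have form: "star n p * p = smult (cnj c * c) (root_form n x)"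
    by (simp add: assms(1) star_smult root_form_def mult.commute)
  then have "cnj c * c = 1 / coeff (root_form n x) n"
    using assms(2) coeff_root_form_nonzero[of n x] by (simp add: field_simps)
  then show ?thesis
    by (simp only: form root_state_def)
qed

lemma root_state_image: "root_state n ` topspace (torus n) = pure_states (Suc n)"
proof (intro equalityI subsetI)
  fix \<phi> assume "\<phi> \<in> root_state n ` topspace (torus n)"
  then obtain x where "x \<in> topspace (torus n)" and \<phi>: "\<phi> = root_state n x"
    by blast
  then have x: "\<And>i. i < n \<Longrightarrow> cmod (x i) = 1"
    by (simp add: in_torus)
  obtain r where r: "0 < r" "coeff (root_form n x) n = complex_of_real r"
    by (rule coeff_root_form_pos)
  define c where "c = complex_of_real (1 / sqrt r)"
  have c: "cnj c * c = complex_of_real (1 / r)" "c \<noteq> 0"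
    using r(1) by (simp_all add: c_def flip: of_real_mult)
  define p where "p = smult c (root_poly n x)"
  have "star n p * p = smult (cnj c * c) (root_form n x)"
    by (simp add: p_def star_smult root_form_def mult.commute)
  then have norm: "coeff (star n p * p) n = 1"
    using c r by simp
  have "degree p = n" "\<And>w. poly p w = 0 \<Longrightarrow> cmod w = 1"
    using c x by (auto simp: p_def degree_root_poly poly_root_poly_eq_0_iff)
  then have "functional n (star n p * p) \<in> pure_states (Suc n)"
    using norm by (rule pure_state_if_roots_on_circle)
  then show "\<phi> \<in> pure_states (Suc n)"
    using root_state_eq[OF p_def norm] \<phi> by simp
next
  fix \<phi> assume "\<phi> \<in> pure_states (Suc n)"
  then obtain p where p: "degree p = n" "\<And>w. poly p w = 0 \<Longrightarrow> cmod w = 1"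
    "coeff (star n p * p) n = 1" "\<phi> = functional n (star n p * p)"
    by (rule pure_statesE) blast
  obtain x c where xc: "p = smult c (root_poly n x)"
    using p(1) by (rule complex_poly_eq_root_poly)
  \<comment> \<open>Points of the torus are \<open>undefined\<close> from index \<open>n\<close>
    on.\<close>
  define y where "y = restrict x {..<n}"
  have y: "p = smult c (root_poly n y)"
    unfolding xc by (auto simp: y_def intro!: arg_cong[of _ _ "smult c"] root_poly_cong)
  have "cmod (y i) = 1" if "i < n" for i
    using that by (intro p(2)) (auto simp: y poly_root_poly_eq_0_iff)
  then have "y \<in> topspace (torus n)"
    by (simp add: in_torus y_def)
  then show "\<phi> \<in> root_state n ` topspace (torus n)"
    using root_state_eq[OF y p(3)] p(4) by auto
qed

text \<open>The state determines the square of \<open>root_poly\<close> up to a scalar, hence the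
  multiset of zeroes with all multiplicities doubled. Cancelling the 2 leaves equal multisets of
  coordinates, which differ by a permutation.\<close>

lemma root_state_eq_iff:
  assumes x: "x \<in> topspace (torus n)" and y: "y \<in> topspace (torus n)"
  shows "root_state n x = root_state n y \<longleftrightarrow> (x, y) \<in> perm_rel n"
proof
  assume "root_state n x = root_state n y"
  then have eq: "smult (1 / coeff (root_form n x) n) (root_form n x) =
      smult (1 / coeff (root_form n y) n) (root_form n y)"
    unfolding root_state_def by (intro functional_inject[of _ n]) (simp_all add: degree_root_form)
  have form: "\<exists>c. c \<noteq> 0 \<and> smult (1 / coeff (root_form n z) n) (root_form n z) = smult c (root_poly n z ^ 2)"
    if "z \<in> topspace (torus n)" for z
  proof -
    have "cmod (z i) = 1" if "i < n" for i
      using \<open>z \<in> topspace (torus n)\<close> that by (simp add: in_torus)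
    then obtain c where c: "c \<noteq> 0" "star n (root_poly n z) = smult c (root_poly n z)"
      using star_root_poly[of n z] by blast
    then have "smult (1 / coeff (root_form n z) n) (root_form n z) =
        smult (c / coeff (root_form n z) n) (root_poly n z ^ 2)"
      unfolding root_form_def by (simp add: power2_eq_square)
    then show ?thesis
      using c coeff_root_form_nonzero by (intro exI[of _ "c / coeff (root_form n z) n"]) auto
  qed
  obtain c d where "c \<noteq> 0" "d \<noteq> 0" "smult c (root_poly n x ^ 2) = smult d (root_poly n y ^ 2)"
    using form[OF x] form[OF y] eq by metis
  then have "repeat_mset 2 (proots (root_poly n x)) = repeat_mset 2 (proots (root_poly n y))"
    by (metis proots_power proots_smult)
  then have "image_mset y (mset_set {..<n}) = image_mset x (mset_set {..<n})"
    by (simp add: repeat_mset_cancel1 proots_root_poly)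
  then obtain p where p: "p permutes {..<n}" "\<forall>i\<in>{..<n}. y i = x (p i)"
    by (rule image_mset_eq_implies_permutes[OF finite_lessThan])
  have "y i = x (p i)" for i
  proof (cases "i < n")
    case False
    then have "p i = i"
      using permutes_not_in[OF p(1), of i] by simp
    then show ?thesis
      using False x y by (simp add: in_torus)
  qed (use p in auto)
  then have "y = x \<circ> p"
    by (intro ext) simp
  then show "(x, y) \<in> perm_rel n"
    unfolding in_perm_rel using x p(1) by blast
next
  assume "(x, y) \<in> perm_rel n"
  then obtain p where p: "p permutes {..<n}" "y = x \<circ> p"
    unfolding in_perm_rel by blast
  have "root_poly n x = root_poly n y"
    unfolding root_poly_def p(2) using prod.permute[OF p(1), of "\<lambda>i. [:- x i, 1:]"] by (simp add: o_def)
  then show "root_state n x = root_state n y"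
    by (simp add: root_state_def root_form_def)
qed

text \<open>The induction runs over the number \<open>m\<close> of factors, while the torus keeps
  its \<open>n\<close> coordinates, so that the projection to each root is continuous on a fixed
  space.\<close>

lemma tendsto_coeff_root_poly:
  assumes x: "x \<in> topspace (torus n)" and "m \<le> n"
  shows "((\<lambda>y. coeff (root_poly m y) k) \<longlongrightarrow> coeff (root_poly m x) k) (atin (torus n) x)"
  using assms(2)
proof (induction m arbitrary: k)
  case (Suc m)
  have "continuous_map (torus n) (top_of_set (sphere 0 1)) (\<lambda>y. y m)"
    unfolding torus_def using Suc.prems by (intro continuous_map_product_projection) simp
  then have "continuous_map (torus n) euclidean (\<lambda>y. y m)"
    by (simp add: continuous_map_in_subtopology)
  then have proj: "((\<lambda>y. y m) \<longlongrightarrow> x m) (atin (torus n) x)"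
    using x by (simp add: continuous_map_atin)
  have coeff: "coeff (root_poly (Suc m) y) k = (if k = 0 then 0 else coeff (root_poly m y) (k - 1)) - y m * coeff (root_poly m y) k" for y
    by (cases k) (simp_all add: root_poly_Suc)
  show ?case
    unfolding coeff using Suc.prems
    by (cases "k = 0") (auto intro!: tendsto_intros proj Suc.IH)
qed simp

lemma continuous_map_root_state: "continuous_map (torus n) (weak_star (Suc n)) (root_state n)"
  unfolding weak_star_def
proof (rule continuous_map_into_subtopology)
  show "root_state n \<in> topspace (torus n) \<rightarrow> dual (Suc n)"
    by (auto simp: root_state_def functional_in_dual)
  have form: "((\<lambda>y. coeff (root_form n y) k) \<longlongrightarrow> coeff (root_form n x) k) (atin (torus n) x)"
    if "x \<in> topspace (torus n)" for x k
    unfolding root_form_def coeff_mult coeff_star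
    by (intro tendsto_sum tendsto_mult tendsto_coeff_root_poly[OF that order_refl])
       (auto intro!: tendsto_cnj tendsto_coeff_root_poly[OF that order_refl])
  have "continuous_map (torus n) euclidean (\<lambda>x. root_state n x T)" if "T \<in> toeplitz_sys (Suc n)" for T
    unfolding continuous_map_atin root_state_def functional_def tsum_def using that
    by (auto intro!: tendsto_intros form coeff_root_form_nonzero)
  then show "continuous_map (torus n) (product_topology (\<lambda>_. euclidean) (toeplitz_sys (Suc n))) (root_state n)"
    unfolding continuous_map_componentwise
    by (auto simp: root_state_def functional_def)
qed

section \<open>The pure state space as a compact Hausdorff quotient of the torus\<close>

lemma Hausdorff_weak_star: "Hausdorff_space (weak_star n)"
  unfolding weak_star_def
  by (intro Hausdorff_space_subtopology) (simp add: Hausdorff_space_product_topology)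

lemma compact_space_torus: "compact_space (torus n)"
  unfolding torus_def by (simp add: compact_space_product_topology compact_space_subtopology)

lemma closedin_pure_states: "closedin (weak_star (Suc n)) (pure_states (Suc n))"
proof -
  have "compactin (weak_star (Suc n)) (root_state n ` topspace (torus n))"
    using image_compactin continuous_map_root_state compact_space_torus compact_space_def by blast
  then show ?thesis
    unfolding root_state_image by (rule compactin_imp_closedin[OF Hausdorff_weak_star])
qed

text \<open>A continuous surjection from a compact onto a Hausdorff space is closed, hence a
  quotient map. \<open>root_state\<close> and the projection to orbits are therefore two quotient
  maps with the same fibres, and the induced map \<open>g\<close> is an injective quotient
  map.\<close>

lemma pure_state_space_homeomorphic: "pure_state_space (Suc n) homeomorphic_space torus_mod_sym n"
proof -
  let ?r = "\<lambda>x. perm_rel n `` {x}"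
  have space: "pure_state_space (Suc n) = subtopology (weak_star (Suc n)) (pure_states (Suc n))"
    unfolding pure_state_space_def by (simp add: closure_of_closedin closedin_pure_states)
  have top: "topspace (pure_state_space (Suc n)) = pure_states (Suc n)"
    unfolding space using closedin_subset[OF closedin_pure_states] by auto
  have cont: "continuous_map (torus n) (pure_state_space (Suc n)) (root_state n)"
    unfolding space using continuous_map_root_state root_state_image
    by (intro continuous_map_into_subtopology) auto
  have Haus: "Hausdorff_space (pure_state_space (Suc n))"
    unfolding space by (intro Hausdorff_space_subtopology Hausdorff_weak_star)
  have quot: "quotient_map (torus n) (pure_state_space (Suc n)) (root_state n)"
    by (intro continuous_closed_imp_quotient_map cont continuous_imp_closed_map compact_space_torus Haus)
       (simp add: root_state_image top)
  have classes: "?r x = ?r y \<longleftrightarrow> (x, y) \<in> perm_rel n" if "x \<in> topspace (torus n)" "y \<in> topspace (torus n)" for x y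
    using eq_equiv_class_iff[OF equiv_perm_rel that] .
  have proj: "quotient_map (torus n) (torus_mod_sym n) ?r"
    unfolding torus_mod_sym_def by (rule quotient_map_quotient_topology)
  obtain g where g: "continuous_map (torus_mod_sym n) (pure_state_space (Suc n)) g"
    "\<And>x. x \<in> topspace (torus n) \<Longrightarrow> g (?r x) = root_state n x"
    using quotient_map_lift_exists[OF proj cont] classes root_state_eq_iff by metis
  have "quotient_map (torus n) (pure_state_space (Suc n)) (g \<circ> ?r)"
    by (rule quotient_map_eq[OF quot]) (simp add: g)
  then have "quotient_map (torus_mod_sym n) (pure_state_space (Suc n)) g"
    using quotient_map_from_composition[OF quotient_imp_continuous_map[OF proj] g(1)] by blast
  moreover have "inj_on g (topspace (torus_mod_sym n))"
  proof (rule inj_onI)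
    fix u v assume "u \<in> topspace (torus_mod_sym n)" "v \<in> topspace (torus_mod_sym n)" and eq: "g u = g v"
    then obtain x y where xy: "x \<in> topspace (torus n)" "y \<in> topspace (torus n)" "u = ?r x" "v = ?r y"
      unfolding quotient_imp_surjective_map[OF proj, symmetric] by blast
    then show "u = v"
      using eq g(2) classes root_state_eq_iff by metis
  qed
  ultimately have "homeomorphic_map (torus_mod_sym n) (pure_state_space (Suc n)) g"
    unfolding homeomorphic_map_def by blast
  then show ?thesis
    using homeomorphic_map_imp_homeomorphic_space homeomorphic_space_sym by blast
qed

theorem proposition4p8:
  fixes n :: nat
  assumes "n \<ge> 1"
  shows "({T. spans_extreme_ray n T} =
            {complex_of_real r \<cdot>\<^sub>m gamma_toeplitz n z | r z. 0 < r \<and> cmod z = 1} \<and>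
          {T. spans_extreme_ray n T} =
            {complex_of_real r \<cdot>\<^sub>m toeplitz_mat n (\<lambda>k. z powi k) | r z. 0 < r \<and> cmod z = 1}) \<and>
         pure_states (n + 1) =
           {vector_functional (n + 1) \<xi> | \<xi>.
              \<xi> \<in> carrier_vec (n + 1) \<and> hinner \<xi> \<xi> = 1 \<and>
              all_zeroes_on_circle n (vec_poly n \<xi>)} \<and>
         pure_state_space (n + 1) homeomorphic_space torus_mod_sym n"
proof -
  \<comment> \<open>The extreme rays concern matrices of size n, the states those of size n + 1;
    hence the index shift in the first part only.\<close>
  obtain m where m: "n = Suc m"
    using assms by (cases n) auto
  have "{T. spans_extreme_ray n T} =
      {complex_of_real r \<cdot>\<^sub>m gamma_toeplitz n z | r z. 0 < r \<and> cmod z = 1}"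
    unfolding m extreme_rays_eq gamma_rays_eq ..
  moreover have "{T. spans_extreme_ray n T} =
      {complex_of_real r \<cdot>\<^sub>m toeplitz_mat n (\<lambda>k. z powi k) | r z. 0 < r \<and> cmod z = 1}"
    unfolding m by (rule extreme_rays_eq)
  ultimately show ?thesis
    using pure_states_eq[OF assms] pure_state_space_homeomorphic[of n] by (simp only: Suc_eq_plus1 simp_thms)
qed

end
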